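(* Let $G=\frac1n\sum_{i=1}^nG_i$ with $G_i:\mathbb{R}^p\to\mathbb{R}^p$ and $T:\mathbb{R}^p\rightrightarrows2^{\mathbb{R}^p}$. Suppose that: $\{x:0\in Gx+Tx\}\ne\emptyset$; $T$ is maximally monotone; there is $L>0$ with $\frac1n\sum_{i=1}^n\|G_ix-G_iy\|^2\le L^2\|x-y\|^2$ for all $x,y\in\mathbb{R}^p$; and there exist $x^\star$ with $0\in Gx^\star+Tx^\star$ and $\kappa\ge0$ such that $\langle Gx+v,x-x^\star\rangle\ge-\kappa\|Gx+v\|^2$ for all $x\in\mathrm{dom}(T)$, $v\in Tx$. Let $\gamma\in(\frac12,1)$, let $b\in\{1,\dots,n\}$ and $\mathbf{p}\in(0,1)$ satisfy $b\mathbf{p}^2\le1$, and set $$\rho:=\frac{\mathbf{p}}2,\quad C:=\frac{4-6\mathbf{p}+3\mathbf{p}^2}{b\mathbf{p}},\quad\hat C:=\frac{2\gamma^2(2-3\mathbf{p}+\mathbf{p}^2)}{b\mathbf{p}},\quad M:=4\gamma^2+\frac{4\gamma}{1-\gamma}\cdot\frac{C+\hat C}\rho.$$ Assume $L\kappa<\delta:=\frac{\gamma(2\gamma-1)}{(3\gamma-1)\sqrt M}$. Let $\{(x^k,v^k)\}$ be generated from $x^0\in\mathrm{dom}(T)$, $v^0\in Tx^0$ by $$x^{k+1}=x^k-\eta\widetilde S^k_\gamma-\eta\big(\gamma v^{k+1}-(2\gamma-1)v^k\big),\qquad v^{k+1}\in Tx^{k+1},\quad k\ge0,$$ using the loopless-SVRG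 estimator $\widetilde S^k_\gamma$ (see context) with parameters $b,\mathbf{p}$, and $\eta:=\frac1{L\sqrt M}$. Then $\eta\ge\frac{\sigma\sqrt b\,\mathbf{p}}L$ with $\sigma:=\frac{\sqrt{1-\gamma}}{2\sqrt{8+\gamma+7\gamma^2}}$, and for every $K\ge0$, $$\frac1{K+1}\sum_{k=0}^K\mathbb{E}\big[\|Gx^k+v^k\|^2\big]\le\frac{\hat\Theta_1L^2\hat R_0^2}{\sigma^2b\mathbf{p}^2(K+1)},$$ where $\hat R_0^2:=\|x^0-x^\star\|^2+\gamma^2\eta^2\|Gx^0+v^0\|^2$ and $\hat\Theta_1:=\frac{(3\gamma-1)\eta}{(1-\gamma)[\gamma(2\gamma-1)\eta-(3\gamma-1)\kappa]}$. Moreover, for given $\epsilon>0$, if $\mathbf{p}:=n^{-1/3}$ and $b:=\lfloor n^{2/3}\rfloor$ (with $n\ge2$), then with $\Gamma:=\hat\Theta_1/\sigma^2$ the method requires $$\mathcal{T}_{G_i}:=n+\Big\lfloor\frac{4\Gamma L^2\hat R_0^2n^{2/3}}{\epsilon^2}\Big\rfloor\ \text{evaluations of the }G_i\quad\text{and}\quad\mathcal{T}_T:=\Big\lfloor\frac{\Gamma L^2\hat R_0^2}{\epsilon^2}\Big\rfloor\ \text{evaluations of }J_{\gamma\eta T}$$ to achieve $\frac1{K+1}\sum_{k=0}^K\mathbb{E}[\|Gx^k+v^k\|^2]\le\epsilon^2$; that is, there is $K$ for which this inequality holds and such that producing $x^0,\dots,x^K$ uses at most $\mathcal{T}_{G_i}$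 evaluations of the $G_i$ (in expectation over the snapshot coin flips) and at most $\mathcal{T}_T$ evaluations of $J_{\gamma\eta T}$.
   Context: Norms and inner products are Euclidean; $x^0,v^0$ are deterministic and $x^{-1}:=x^0$. $J_{\gamma\eta T}:=(I+\gamma\eta T)^{-1}$; one step of the scheme is $x^{k+1}=J_{\gamma\eta T}\big(x^k-\eta\widetilde S^k_\gamma+(2\gamma-1)\eta v^k\big)$, with $v^{k+1}$ then determined by the displayed recursion. Loopless-SVRG estimator. Put $w^0:=x^0$. At each iteration $k\ge0$, a mini-batch $\mathcal{B}_k\subseteq\{1,\dots,n\}$ of fixed size $b$ is drawn uniformly at random, independently of everything generated before; with $G_{\mathcal{B}_k}z:=\frac1b\sum_{i\in\mathcal{B}_k}G_iz$ one sets $$\widetilde S^k_\gamma:=(1-\gamma)\big(Gw^k-G_{\mathcal{B}_k}w^k\big)+G_{\mathcal{B}_k}x^k-\gamma G_{\mathcal{B}_k}x^{k-1}$$ (so $\widetilde S^0_\gamma=(1-\gamma)Gx^0$). After computing $x^{k+1}$, by an independent coin flip, $w^{k+1}:=x^k$ with probability $\mathbf{p}$ and $w^{k+1}:=w^k$ with probability $1-\mathbf{p}$. Counting of evaluations: $n$ for the initial $Gw^0$; $3b$ per iteration; $n$ more whenever the snapshot is refreshed (probability $\mathbf{p}$ per iteration), i.e. $n\mathbf{p}+3b$ per iteration in expectation; one evaluation of $J_{\gamma\eta T}$ per iteration. Producing $x^0,\dots,x^K$ takes $K$ iterations. *)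

theory Defs
  imports "HOL-Probability.Probability"
begin

definition op_dom :: "('a \<Rightarrow> 'a set) \<Rightarrow> 'a set" where
  "op_dom T = {x. T x \<noteq> {}}"

definition monotone_op :: "('a::real_inner \<Rightarrow> 'a set) \<Rightarrow> bool" where
  "monotone_op T \<longleftrightarrow> (\<forall>x y. \<forall>u\<in>T x. \<forall>v\<in>T y. 0 \<le> inner (u - v) (x - y))"

definition maximally_monotone :: "('a::real_inner \<Rightarrow> 'a set) \<Rightarrow> bool" where
  "maximally_monotone T \<longleftrightarrow>
     monotone_op T \<and> (\<forall>T'. monotone_op T' \<and> (\<forall>x. T x \<subseteq> T' x) \<longrightarrow> T' = T)"

definition zeros_of_sum :: "('a::real_vector \<Rightarrow> 'a) \<Rightarrow> ('a \<Rightarrow> 'a set) \<Rightarrow> 'a set" where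
  "zeros_of_sum G T = {x. 0 \<in> (\<lambda>v. G x + v) ` T x}"

text \<open>With \<open>B = {1..n}\<close> this is the full operator \<open>G\<close>; with \<open>B\<close> a mini-batch of size \<open>b\<close>
  it is the mini-batch operator \<open>(1/b) \<Sum>i\<in>B. Gs i z\<close>.\<close>

definition batch_mean :: "(nat \<Rightarrow> 'a \<Rightarrow> 'a::real_vector) \<Rightarrow> nat set \<Rightarrow> 'a \<Rightarrow> 'a" where
  "batch_mean Gs B z = (1 / real (card B)) *\<^sub>R (\<Sum>i\<in>B. Gs i z)"

text \<open>The arguments \<open>w\<close>, \<open>x\<close>, \<open>x'\<close> are the snapshot and the current and previous iterates.\<close>

definition lsvrg_estimator ::
  "(nat \<Rightarrow> 'a \<Rightarrow> 'a::real_vector) \<Rightarrow> nat \<Rightarrow> real \<Rightarrow> nat set \<Rightarrow> 'a \<Rightarrow> 'a \<Rightarrow> 'a \<Rightarrow> 'a" where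
  "lsvrg_estimator Gs n \<gamma> B w x x' =
     (1 - \<gamma>) *\<^sub>R (batch_mean Gs {1..n} w - batch_mean Gs B w)
       + batch_mean Gs B x - \<gamma> *\<^sub>R batch_mean Gs B x'"

text \<open>The randomness of the method: in iteration \<open>k\<close> a mini-batch \<open>B k\<close> and a coin \<open>c k\<close>
  (\<open>True\<close> meaning that the snapshot is refreshed). Independence of the pairs over \<open>k\<close>, together
  with the product law of each pair, says that all mini-batches and coins are mutually
  independent. Since the starting point is deterministic and every iterate is a function of
  earlier draws, each draw is then independent of everything generated before it.\<close>

locale lsvrg_sampling = prob_space \<Omega>
  for \<Omega> :: "'w measure" and n b :: nat and p :: real
    and B :: "nat \<Rightarrow> 'w \<Rightarrow> nat set" and c :: "nat \<Rightarrow> 'w \<Rightarrow> bool" +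
  assumes batch: "\<And>k \<omega>. \<omega> \<in> space \<Omega> \<Longrightarrow> B k \<omega> \<subseteq> {1..n} \<and> card (B k \<omega>) = b"
    and indep: "indep_vars (\<lambda>_. count_space UNIV) (\<lambda>k \<omega>. (B k \<omega>, c k \<omega>)) UNIV"
    and law: "\<And>k. distr \<Omega> (count_space UNIV) (\<lambda>\<omega>. (B k \<omega>, c k \<omega>)) =
      measure_pmf (pair_pmf (pmf_of_set {S. S \<subseteq> {1..n} \<and> card S = b}) (bernoulli_pmf p))"

text \<open>Evaluations used by the first \<open>K\<close> iterations, which produce \<open>x\<^sup>0, \<dots>, x\<^sup>K\<close>. For the component
  operators: \<open>n\<close> for the initial snapshot, \<open>3 * b\<close> per iteration, and \<open>n\<close> more for every
  refresh, so the count depends on the coins \<open>cs\<close>. For the resolvent: one per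
  iteration, since the step is \<open>x\<^sup>k\<^sup>+\<^sup>1 = (I + \<gamma>\<eta>T)\<^sup>-\<^sup>1 (x\<^sup>k - \<eta>S\<^sup>k + (2\<gamma> - 1)\<eta>v\<^sup>k)\<close>.\<close>

definition component_evals :: "nat \<Rightarrow> nat \<Rightarrow> (nat \<Rightarrow> bool) \<Rightarrow> nat \<Rightarrow> nat" where
  "component_evals n b cs K = n + (\<Sum>k<K. 3 * b + (if cs k then n else 0))"

definition resolvent_evals :: "nat \<Rightarrow> nat" where
  "resolvent_evals K = (\<Sum>k<K. 1)"

end

theory Submission
  imports Defs
begin

text \<open>
  The idea is to follow the shifted iterate \<open>z\<^sub>k = x\<^sub>k + \<gamma>\<eta>W\<^sub>k\<close>, where \<open>W\<^sub>k = G x\<^sub>k\<^sub>-\<^sub>1 + v\<^sub>k\<close>, instead of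
  \<open>x\<^sub>k\<close> itself. With the residual \<open>F\<^sub>k = G x\<^sub>k + v\<^sub>k\<close> and the error \<open>e\<^sub>k\<close> of the estimator, the
  recursion becomes the explicit \<open>z\<^sub>k\<^sub>+\<^sub>1 = z\<^sub>k - (1 - \<gamma>)\<eta>F\<^sub>k - \<eta>e\<^sub>k\<close> (\<open>z_step\<close>). The squared distance of
  \<open>z\<^sub>k\<close> from the solution plus \<open>(1 - \<gamma>) / (3\<gamma> - 1)\<close> times the squared norm of \<open>z\<^sub>k - x\<^sub>k\<^sub>-\<^sub>1\<close> is a
  Lyapunov function: by the weak Minty inequality it decreases by a multiple of the squared norm of \<open>F\<^sub>k\<close>
  and a multiple of that of the step \<open>x\<^sub>k - x\<^sub>k\<^sub>-\<^sub>1\<close>, up to the variance of \<open>e\<^sub>k\<close> (\<open>lyapunov_descent\<close>).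

  The variance is bounded by the mean square of a control variate (\<open>mean_norm_batch_error_le\<close>). Since
  the snapshot is refreshed with probability \<open>p\<close>, that mean square contracts by the factor \<open>1 - p / 2\<close>
  up to squared steps (\<open>xi_mean_sq_step\<close>). Hence the summed variances are at most a constant times the
  summed squared steps, and the step size \<open>\<eta>\<close> is chosen such that the decrease just pays for them. What
  remains is a bound on the sum of the expected squared residuals (\<open>residual_sum_le\<close>), with the factor
  \<open>1 / \<eta>\<^sup>2 = L\<^sup>2 M\<close>, which \<open>M_bounds\<close> compares with \<open>L\<^sup>2 / (\<sigma>\<^sup>2 b p\<^sup>2)\<close>.

  The evaluation counts are not a direct consequence of that comparison: for \<open>p = n\<^bsup>-1/3\<^esup>\<close> and
  \<open>b = \<lfloor>n\<^bsup>2/3\<^esup>\<rfloor>\<close> the product \<open>b p\<^sup>2\<close> is in general smaller than \<open>1\<close>, and the count itself is rounded down.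
  Both losses are made up by the sharper estimate \<open>\<sigma>\<^sup>2 (1 + p\<^sup>2 / 4) M \<le> 1\<close>, valid for these
  parameters (\<open>M_bounds\<close>, \<open>iteration_count\<close>).
\<close>

section \<open>Batches drawn without replacement\<close>

definition batches :: "'i set \<Rightarrow> nat \<Rightarrow> 'i set set" where
  "batches A b = {S. S \<subseteq> A \<and> card S = b}"

lemma finite_batches: "finite A \<Longrightarrow> finite (batches A b)"
  unfolding batches_def by auto

lemma card_batches: "finite A \<Longrightarrow> card (batches A b) = card A choose b"
  unfolding batches_def by (rule n_subsets)

text \<open>A batch containing \<open>Q\<close> is \<open>Q\<close> together with a smaller batch from the complement of \<open>Q\<close>.
  Only the consequence matters below: the number of batches through one index, or through two
  distinct indices, does not depend on the indices.\<close>

lemma card_batches_containing: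
  assumes A: "finite A" and Q: "Q \<subseteq> A" "card Q \<le> b"
  shows "card {S \<in> batches A b. Q \<subseteq> S} = (card A - card Q) choose (b - card Q)"
proof -
  have fQ: "finite Q" using A Q finite_subset by blast
  have "bij_betw (\<lambda>R. R \<union> Q) (batches (A - Q) (b - card Q)) {S \<in> batches A b. Q \<subseteq> S}"
  proof (rule bij_betw_byWitness[where f' = "\<lambda>S. S - Q"])
    show "(\<lambda>R. R \<union> Q) ` batches (A - Q) (b - card Q) \<subseteq> {S \<in> batches A b. Q \<subseteq> S}"
    proof
      fix S assume "S \<in> (\<lambda>R. R \<union> Q) ` batches (A - Q) (b - card Q)"
      then obtain R where R: "S = R \<union> Q" "R \<subseteq> A - Q" "card R = b - card Q"
        by (auto simp: batches_def)
      moreover have "finite R" using R(2) A by (meson finite_Diff finite_subset)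
      moreover have "card (R \<union> Q) = card R + card Q"
        using \<open>finite R\<close> fQ R(2) by (intro card_Un_disjoint) auto
      ultimately show "S \<in> {S \<in> batches A b. Q \<subseteq> S}" using Q by (auto simp: batches_def)
    qed
    show "(\<lambda>S. S - Q) ` {S \<in> batches A b. Q \<subseteq> S} \<subseteq> batches (A - Q) (b - card Q)"
      using fQ by (auto simp: batches_def card_Diff_subset)
  qed (auto simp: batches_def)
  then have "card {S \<in> batches A b. Q \<subseteq> S} = card (batches (A - Q) (b - card Q))"
    by (simp add: bij_betw_same_card)
  then show ?thesis using A Q fQ by (simp add: card_batches card_Diff_subset)
qed

lemma sum_over_batches:
  fixes f :: "'i \<Rightarrow> 'a::real_vector"
  assumes A: "finite A" and b: "b > 0"
  shows "(\<Sum>S\<in>batches A b. \<Sum>i\<in>S. f i)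
    = real ((card A - 1) choose (b - 1)) *\<^sub>R (\<Sum>i\<in>A. f i)"
proof -
  have "(\<Sum>S\<in>batches A b. \<Sum>i\<in>S. f i) = (\<Sum>S\<in>batches A b. \<Sum>i\<in>A. if i \<in> S then f i else 0)"
  proof (rule sum.cong[OF refl])
    fix S assume "S \<in> batches A b"
    then have "{i \<in> A. i \<in> S} = S" by (auto simp: batches_def)
    then show "sum f S = (\<Sum>i\<in>A. if i \<in> S then f i else 0)"
      using A by (simp add: sum.inter_filter[symmetric])
  qed
  also have "\<dots> = (\<Sum>i\<in>A. \<Sum>S\<in>batches A b. if i \<in> S then f i else 0)" by (rule sum.swap)
  also have "\<dots> = (\<Sum>i\<in>A. real ((card A - 1) choose (b - 1)) *\<^sub>R f i)"
  proof (rule sum.cong[OF refl])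
    fix i assume i: "i \<in> A"
    have "(\<Sum>S\<in>batches A b. if i \<in> S then f i else 0)
        = real (card {S \<in> batches A b. {i} \<subseteq> S}) *\<^sub>R f i"
      using finite_batches[OF A] by (simp add: sum.inter_filter[symmetric] sum_constant_scaleR)
    also have "card {S \<in> batches A b. {i} \<subseteq> S} = (card A - 1) choose (b - 1)"
      using card_batches_containing[OF A, of "{i}" b] i b by simp
    finally show "(\<Sum>S\<in>batches A b. if i \<in> S then f i else 0)
        = real ((card A - 1) choose (b - 1)) *\<^sub>R f i" .
  qed
  finally show ?thesis by (simp add: scaleR_right.sum)
qed

lemma batches_containing_point:
  assumes A: "finite A" and b: "b > 0"
  shows "real b * real (card (batches A b)) = real ((card A - 1) choose (b - 1)) * real (card A)"
proof -
  have "(\<Sum>S\<in>batches A b. \<Sum>i\<in>S. 1::real) = real (card (batches A b)) * real b"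
    by (simp add: batches_def)
  then show ?thesis using sum_over_batches[OF A b, of "\<lambda>_. 1::real"]
    by (simp only: mult.commute real_scaleR_def sum_constant mult_1_left)
qed

text \<open>Expanding the squares, the diagonal terms occur once for each batch through a given index
  (\<open>\<alpha>\<close> times) and the mixed ones once for each batch through a given pair (\<open>\<beta>\<close> times). Since the
  summands add up to zero, replacing all multiplicities by \<open>\<beta>\<close> gives zero, so the total is
  \<open>\<alpha> - \<beta>\<close> times the sum of the squared norms: drawing without replacement is never worse than
  drawing with replacement.\<close>

lemma sum_norm_batch_sums_le:
  fixes \<zeta> :: "'i \<Rightarrow> 'a::real_inner"
  assumes A: "finite A" and b: "b > 0" and centred: "(\<Sum>i\<in>A. \<zeta> i) = 0"
  shows "(\<Sum>S\<in>batches A b. (norm (\<Sum>i\<in>S. \<zeta> i))\<^sup>2)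
    \<le> real ((card A - 1) choose (b - 1)) * (\<Sum>i\<in>A. (norm (\<zeta> i))\<^sup>2)"
proof -
  define \<alpha> where "\<alpha> = real ((card A - 1) choose (b - 1))"
  define \<beta> where "\<beta> = (if b \<ge> 2 then real ((card A - 2) choose (b - 2)) else 0)"
  have count: "real (card {S \<in> batches A b. {i, j} \<subseteq> S}) = (if i = j then \<alpha> else \<beta>)"
    if "i \<in> A" "j \<in> A" for i j
  proof (cases "i = j \<or> b \<ge> 2")
    case True
    then have "card {i, j} \<le> b" using b by (cases "i = j") auto
    then show ?thesis using card_batches_containing[OF A, of "{i, j}" b] that True
      by (auto simp: \<alpha>_def \<beta>_def numeral_2_eq_2)
  next
    case False
    have "False" if "S \<in> batches A b" "{i, j} \<subseteq> S" for S
    proof -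
      have "finite S" using that A finite_subset unfolding batches_def by blast
      then have "card {i, j} \<le> card S" using that by (intro card_mono)
      then show False using False that by (auto simp: batches_def)
    qed
    then have "{S \<in> batches A b. {i, j} \<subseteq> S} = {}" by blast
    then show ?thesis using False by (simp only: \<beta>_def) simp
  qed
  have "(\<Sum>S\<in>batches A b. (norm (\<Sum>i\<in>S. \<zeta> i))\<^sup>2)
      = (\<Sum>S\<in>batches A b. \<Sum>i\<in>A. \<Sum>j\<in>A. if {i, j} \<subseteq> S then inner (\<zeta> i) (\<zeta> j) else 0)"
  proof (rule sum.cong[OF refl])
    fix S assume "S \<in> batches A b"
    then have S: "{i \<in> A. i \<in> S} = S" by (auto simp: batches_def)
    have "(norm (\<Sum>i\<in>S. \<zeta> i))\<^sup>2 = (\<Sum>i\<in>S. \<Sum>j\<in>S. inner (\<zeta> i) (\<zeta> j))"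
      by (simp add: power2_norm_eq_inner inner_sum_left inner_sum_right inner_commute)
    also have "\<dots> = (\<Sum>i\<in>A. if i \<in> S then \<Sum>j\<in>A. if j \<in> S then inner (\<zeta> i) (\<zeta> j) else 0 else 0)"
      using A by (simp add: sum.inter_filter[symmetric] S)
    also have "\<dots> = (\<Sum>i\<in>A. \<Sum>j\<in>A. if {i, j} \<subseteq> S then inner (\<zeta> i) (\<zeta> j) else 0)"
      by (intro sum.cong) auto
    finally show "(norm (\<Sum>i\<in>S. \<zeta> i))\<^sup>2
        = (\<Sum>i\<in>A. \<Sum>j\<in>A. if {i, j} \<subseteq> S then inner (\<zeta> i) (\<zeta> j) else 0)" .
  qed
  also have "\<dots> = (\<Sum>i\<in>A. \<Sum>j\<in>A. \<Sum>S\<in>batches A b.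
      if {i, j} \<subseteq> S then inner (\<zeta> i) (\<zeta> j) else 0)"
    by (subst sum.swap) (intro sum.cong refl sum.swap)
  also have "\<dots> = (\<Sum>i\<in>A. \<Sum>j\<in>A. (if i = j then \<alpha> else \<beta>) * inner (\<zeta> i) (\<zeta> j))"
  proof (intro sum.cong refl)
    fix i j assume ij: "i \<in> A" "j \<in> A"
    have "(\<Sum>S\<in>batches A b. if {i, j} \<subseteq> S then inner (\<zeta> i) (\<zeta> j) else 0)
        = real (card {S \<in> batches A b. {i, j} \<subseteq> S}) * inner (\<zeta> i) (\<zeta> j)"
      using finite_batches[OF A] by (simp add: sum.inter_filter[symmetric])
    then show "(\<Sum>S\<in>batches A b. if {i, j} \<subseteq> S then inner (\<zeta> i) (\<zeta> j) else 0)
        = (if i = j then \<alpha> else \<beta>) * inner (\<zeta> i) (\<zeta> j)" using count[OF ij] by simp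
  qed
  also have "\<dots> = (\<Sum>i\<in>A. \<Sum>j\<in>A. \<beta> * inner (\<zeta> i) (\<zeta> j)
      + (if i = j then (\<alpha> - \<beta>) * inner (\<zeta> i) (\<zeta> j) else 0))"
    by (intro sum.cong refl) (simp add: algebra_simps)
  also have "\<dots> = (\<Sum>i\<in>A. \<beta> * inner (\<zeta> i) (\<Sum>j\<in>A. \<zeta> j) + (\<alpha> - \<beta>) * (norm (\<zeta> i))\<^sup>2)"
    using A by (intro sum.cong refl)
      (simp add: sum.distrib sum_distrib_left inner_sum_right power2_norm_eq_inner)
  also have "\<dots> = (\<alpha> - \<beta>) * (\<Sum>i\<in>A. (norm (\<zeta> i))\<^sup>2)"
    by (simp add: centred sum_distrib_left)
  also have "\<dots> \<le> \<alpha> * (\<Sum>i\<in>A. (norm (\<zeta> i))\<^sup>2)"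
    by (intro mult_right_mono sum_nonneg) (auto simp: \<beta>_def)
  finally show ?thesis by (simp add: \<alpha>_def)
qed

lemma sum_norm_centred_eq:
  fixes \<xi> :: "'i \<Rightarrow> 'a::real_inner"
  assumes A: "finite A"
  defines "m \<equiv> (1 / real (card A)) *\<^sub>R (\<Sum>i\<in>A. \<xi> i)"
  shows "(\<Sum>i\<in>A. (norm (\<xi> i - m))\<^sup>2) = (\<Sum>i\<in>A. (norm (\<xi> i))\<^sup>2) - real (card A) * (norm m)\<^sup>2"
proof (cases "A = {}")
  case False
  then have s: "(\<Sum>i\<in>A. \<xi> i) = real (card A) *\<^sub>R m" using A by (simp add: m_def)
  have "(\<Sum>i\<in>A. (norm (\<xi> i - m))\<^sup>2)
      = (\<Sum>i\<in>A. (norm (\<xi> i))\<^sup>2 - 2 * inner (\<xi> i) m + (norm m)\<^sup>2)"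
    by (intro sum.cong refl) (simp add: power2_norm_eq_inner inner_diff inner_commute algebra_simps)
  also have "\<dots> = (\<Sum>i\<in>A. (norm (\<xi> i))\<^sup>2) - 2 * inner (\<Sum>i\<in>A. \<xi> i) m + real (card A) * (norm m)\<^sup>2"
    by (simp add: sum.distrib sum_subtractf inner_sum_left sum_distrib_left)
  finally show ?thesis by (simp add: s power2_norm_eq_inner)
qed simp

lemma norm_mean_le:
  fixes \<xi> :: "'i \<Rightarrow> 'a::real_inner"
  assumes A: "finite A"
  shows "(norm ((1 / real (card A)) *\<^sub>R (\<Sum>i\<in>A. \<xi> i)))\<^sup>2
    \<le> (1 / real (card A)) * (\<Sum>i\<in>A. (norm (\<xi> i))\<^sup>2)"
proof (cases "A = {}")
  case False
  then have pos: "real (card A) > 0" using A by (simp add: card_gt_0_iff)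
  have "0 \<le> (\<Sum>i\<in>A. (norm (\<xi> i - (1 / real (card A)) *\<^sub>R (\<Sum>i\<in>A. \<xi> i)))\<^sup>2)"
    by (intro sum_nonneg) simp
  then show ?thesis using pos unfolding sum_norm_centred_eq[OF A] by (simp add: field_simps)
qed simp

text \<open>The sampling error made when the mean over \<open>A\<close> is replaced by the mean over \<open>S\<close>.\<close>

definition batch_error :: "'i set \<Rightarrow> ('i \<Rightarrow> 'a::real_vector) \<Rightarrow> 'i set \<Rightarrow> 'a" where
  "batch_error A \<xi> S = (1 / real (card S)) *\<^sub>R (\<Sum>i\<in>S. \<xi> i) - (1 / real (card A)) *\<^sub>R (\<Sum>i\<in>A. \<xi> i)"

context
  fixes A :: "'i set" and b :: nat and \<xi> :: "'i \<Rightarrow> 'a::real_inner"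
  assumes A: "finite A" and b: "0 < b" "b \<le> card A"
begin

text \<open>Subtracting the overall mean from every summand does not change the sampling error, and
  brings it into the form required by \<open>sum_norm_batch_sums_le\<close>.\<close>

private lemma batch_error_centred:
  fixes m defines "m \<equiv> (1 / real (card A)) *\<^sub>R (\<Sum>i\<in>A. \<xi> i)"
  shows "(\<Sum>i\<in>A. \<xi> i - m) = 0"
    and "S \<in> batches A b \<Longrightarrow> batch_error A \<xi> S = (1 / real b) *\<^sub>R (\<Sum>i\<in>S. \<xi> i - m)"
proof -
  have "card A > 0" using b by simp
  then show "(\<Sum>i\<in>A. \<xi> i - m) = 0"
    by (simp add: m_def sum_subtractf sum_constant_scaleR del: sum_constant)
  show "batch_error A \<xi> S = (1 / real b) *\<^sub>R (\<Sum>i\<in>S. \<xi> i - m)" if "S \<in> batches A b"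
    using that b unfolding batch_error_def m_def batches_def
    by (simp add: sum_subtractf sum_constant_scaleR algebra_simps del: sum_constant)
qed

lemma sum_batch_error: "(\<Sum>S\<in>batches A b. batch_error A \<xi> S) = 0"
  using sum_over_batches[OF A b(1), of "\<lambda>i. \<xi> i - (1 / real (card A)) *\<^sub>R (\<Sum>i\<in>A. \<xi> i)"]
  by (simp add: batch_error_centred scaleR_right.sum[symmetric] del: scaleR_eq_0_iff)

text \<open>The second moment of the sampling error, which is the mean square of \<open>\<xi>\<close> divided by the batch
  size. The mean square is left uncentred, because the recursion below is one for the
  uncentred mean square.\<close>

lemma mean_norm_batch_error_le:
  "(\<Sum>S\<in>batches A b. (norm (batch_error A \<xi> S))\<^sup>2) / real (card (batches A b))
    \<le> (1 / (real (card A) * real b)) * (\<Sum>i\<in>A. (norm (\<xi> i))\<^sup>2)"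
proof -
  define m where "m = (1 / real (card A)) *\<^sub>R (\<Sum>i\<in>A. \<xi> i)"
  define \<alpha> where "\<alpha> = real ((card A - 1) choose (b - 1))"
  have N: "real (card (batches A b)) > 0"
    using b by (simp add: card_batches[OF A] zero_less_binomial)
  have \<alpha>: "real b * real (card (batches A b)) = \<alpha> * real (card A)"
    unfolding \<alpha>_def by (rule batches_containing_point[OF A b(1)])
  have "(\<Sum>S\<in>batches A b. (norm (batch_error A \<xi> S))\<^sup>2)
      = (1 / (real b)\<^sup>2) * (\<Sum>S\<in>batches A b. (norm (\<Sum>i\<in>S. \<xi> i - m))\<^sup>2)"
    unfolding m_def sum_distrib_left
    by (intro sum.cong refl) (simp add: batch_error_centred power_divide)
  also have "\<dots> \<le> (1 / (real b)\<^sup>2) * (\<alpha> * (\<Sum>i\<in>A. (norm (\<xi> i - m))\<^sup>2))"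
    unfolding \<alpha>_def m_def
    by (intro mult_left_mono sum_norm_batch_sums_le A b batch_error_centred) simp
  also have "\<dots> \<le> (1 / (real b)\<^sup>2) * (\<alpha> * (\<Sum>i\<in>A. (norm (\<xi> i))\<^sup>2))"
    unfolding m_def sum_norm_centred_eq[OF A]
    by (intro mult_left_mono) (auto simp: \<alpha>_def)
  also have "\<dots> = (1 / (real (card A) * real b)) * (\<Sum>i\<in>A. (norm (\<xi> i))\<^sup>2) * real (card (batches A b))"
  proof -
    have \<alpha>': "\<alpha> = real b * real (card (batches A b)) / real (card A)"
      using \<alpha> b by (simp add: field_simps)
    show ?thesis unfolding \<alpha>' using b by (simp add: power2_eq_square[of "real b"] mult.commute)
  qed
  finally show ?thesis using N by (simp add: divide_le_eq)
qed

end

text \<open>Noise of mean zero is uncorrelated with \<open>u\<close>.\<close>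

lemma mean_norm_shifted:
  fixes u :: "'a::real_inner" and e :: "'i \<Rightarrow> 'a"
  assumes I: "finite I" "I \<noteq> {}" and centred: "(\<Sum>i\<in>I. e i) = 0"
  shows "(\<Sum>i\<in>I. (norm (u - \<eta> *\<^sub>R e i))\<^sup>2) / real (card I)
    = (norm u)\<^sup>2 + \<eta>\<^sup>2 * ((\<Sum>i\<in>I. (norm (e i))\<^sup>2) / real (card I))"
proof -
  have "(\<Sum>i\<in>I. (norm (u - \<eta> *\<^sub>R e i))\<^sup>2)
      = (\<Sum>i\<in>I. (norm u)\<^sup>2 - 2 * \<eta> * inner u (e i) + \<eta>\<^sup>2 * (norm (e i))\<^sup>2)"
    unfolding power2_norm_eq_inner
    by (intro sum.cong refl) (simp add: inner_simps inner_commute power2_eq_square algebra_simps)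
  also have "\<dots> = real (card I) * (norm u)\<^sup>2 - 2 * \<eta> * inner u (\<Sum>i\<in>I. e i) + \<eta>\<^sup>2 * (\<Sum>i\<in>I. (norm (e i))\<^sup>2)"
    by (simp add: sum.distrib sum_subtractf sum_distrib_left inner_sum_right)
  finally show ?thesis using I by (simp add: centred add_divide_distrib)
qed

section \<open>Independent draws from a finite set\<close>

text \<open>Used to turn a quantity determined by the history into a function of the history.\<close>

lemma factor_through:
  assumes "\<And>\<omega> \<omega>'. \<omega> \<in> S \<Longrightarrow> \<omega>' \<in> S \<Longrightarrow> h \<omega> = h \<omega>' \<Longrightarrow> Z \<omega> = Z \<omega>'"
  obtains g where "\<And>\<omega>. \<omega> \<in> S \<Longrightarrow> Z \<omega> = g (h \<omega>)"
proof
  fix \<omega> assume "\<omega> \<in> S"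
  then have "(SOME \<omega>'. \<omega>' \<in> S \<and> h \<omega>' = h \<omega>) \<in> S \<and> h (SOME \<omega>'. \<omega>' \<in> S \<and> h \<omega>' = h \<omega>) = h \<omega>"
    by (intro someI_ex[of "\<lambda>\<omega>'. \<omega>' \<in> S \<and> h \<omega>' = h \<omega>"]) auto
  then show "Z \<omega> = (\<lambda>y. Z (SOME \<omega>'. \<omega>' \<in> S \<and> h \<omega>' = y)) (h \<omega>)"
    using assms[OF \<open>\<omega> \<in> S\<close>] by force
qed

text \<open>Independent draws from a finite set. Everything that the algorithm computes is a function of
  finitely many of them, so it takes finitely many values, and expectations are finite sums: the
  conditional expectation given the past becomes an average over the values of the next draw.\<close>

locale finite_draws = prob_space M for M :: "'w measure" +
  fixes X :: "nat \<Rightarrow> 'w \<Rightarrow> 'd" and A :: "'d set"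
  assumes draws_indep: "indep_vars (\<lambda>_. count_space UNIV) X UNIV"
    and finite_A: "finite A"
    and draws_in: "\<And>k \<omega>. \<omega> \<in> space M \<Longrightarrow> X k \<omega> \<in> A"
begin

definition history :: "nat \<Rightarrow> 'w \<Rightarrow> 'd list" where
  "history k \<omega> = map (\<lambda>j. X j \<omega>) [0..<k]"

lemma history_eq_iff: "history k \<omega> = history k \<omega>' \<longleftrightarrow> (\<forall>j<k. X j \<omega> = X j \<omega>')"
  by (auto simp: history_def)

lemma draw_event [measurable]: "{\<omega> \<in> space M. X k \<omega> = a} \<in> sets M"
proof -
  have "X k \<in> measurable M (count_space UNIV)"
    using draws_indep by (simp add: indep_vars_def)
  from measurable_sets[OF this, of "{a}"] show ?thesis
    by (simp add: vimage_def Int_def conj_commute)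
qed

lemma history_event:
  assumes "length h = k"
  shows "{\<omega> \<in> space M. history k \<omega> = h} = {\<omega> \<in> space M. \<forall>j\<in>{..<k}. X j \<omega> = h ! j}"
  using assms by (auto simp: history_def list_eq_iff_nth_eq)

lemma history_event_sets [measurable]: "{\<omega> \<in> space M. history k \<omega> = h} \<in> sets M"
proof (cases "length h = k")
  case True
  have "{\<omega> \<in> space M. \<forall>j\<in>{..<k}. X j \<omega> = h ! j} \<in> sets M"
    by (intro sets.sets_Collect_finite_All draw_event) simp
  then show ?thesis using True by (simp add: history_event)
next
  case False
  then have "{\<omega> \<in> space M. history k \<omega> = h} = {}" by (auto simp: history_def)
  then show ?thesis by (simp only: sets.empty_sets)
qed

lemma finite_history: "finite (history k ` space M)"
proof (rule finite_subset)
  show "history k ` space M \<subseteq> {xs. set xs \<subseteq> A \<and> length xs = k}"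
    using draws_in by (auto simp: history_def)
  show "finite {xs. set xs \<subseteq> A \<and> length xs = k}" using finite_A by (rule finite_lists_length_eq)
qed

lemma simple_function_history: "simple_function M (history k)"
  unfolding simple_function_def
proof (intro conjI ballI finite_history)
  fix h
  show "history k -` {h} \<inter> space M \<in> sets M"
    using history_event_sets[of k h] by (simp add: vimage_def Int_def conj_commute)
qed

lemma integrable_history:
  fixes g :: "'d list \<Rightarrow> real"
  shows "integrable M (\<lambda>\<omega>. g (history k \<omega>))"
proof (rule integrable_const_bound)
  show "AE \<omega> in M. norm (g (history k \<omega>)) \<le> (\<Sum>h\<in>history k ` space M. norm (g h))"
    using finite_history by (intro AE_I2 member_le_sum) auto
  show "(\<lambda>\<omega>. g (history k \<omega>)) \<in> borel_measurable M"
    by (rule borel_measurable_simple_function[OF simple_function_compose1[OF simple_function_history]])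
qed

text \<open>The iterates are given implicitly, by an inclusion, so their measurability cannot be read off
  from a formula. It comes for free from their being determined by the draws.\<close>

lemma integrable_determined:
  fixes Y :: "'w \<Rightarrow> real"
  assumes "\<And>\<omega> \<omega>'. \<omega> \<in> space M \<Longrightarrow> \<omega>' \<in> space M \<Longrightarrow> history k \<omega> = history k \<omega>' \<Longrightarrow> Y \<omega> = Y \<omega>'"
  shows "integrable M Y"
proof -
  obtain g where "\<And>\<omega>. \<omega> \<in> space M \<Longrightarrow> Y \<omega> = g (history k \<omega>)"
    using factor_through[of "space M" "history k" Y] assms by blast
  then show ?thesis
    using integrable_history[of g k] Bochner_Integration.integrable_cong[OF refl, of M Y "\<lambda>\<omega>. g (history k \<omega>)"]
    by simp
qed

lemma prob_history_next:
  assumes h: "length h = k"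
  shows "prob {\<omega> \<in> space M. history k \<omega> = h \<and> X k \<omega> = a}
    = prob {\<omega> \<in> space M. history k \<omega> = h} * prob {\<omega> \<in> space M. X k \<omega> = a}"
proof -
  define E where "E j = (if j = k then {a} else {h ! j})" for j
  have prod: "prob {\<omega> \<in> space M. \<forall>j\<in>J. X j \<omega> \<in> E j}
      = (\<Prod>j\<in>J. prob {\<omega> \<in> space M. X j \<omega> \<in> E j})" if "finite J" for J
  proof (cases "J = {}")
    case False
    have "prob (\<Inter>j\<in>J. X j -` E j \<inter> space M) = (\<Prod>j\<in>J. prob (X j -` E j \<inter> space M))"
      by (rule indep_varsD[OF draws_indep]) (use that False in auto)
    moreover have "(\<Inter>j\<in>J. X j -` E j \<inter> space M) = {\<omega> \<in> space M. \<forall>j\<in>J. X j \<omega> \<in> E j}"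
      using False by auto
    ultimately show ?thesis by (simp add: vimage_def Int_def conj_commute)
  qed (simp add: prob_space)
  have "{\<omega> \<in> space M. history k \<omega> = h \<and> X k \<omega> = a} = {\<omega> \<in> space M. \<forall>j\<in>{..<Suc k}. X j \<omega> \<in> E j}"
    using h by (auto simp: E_def history_def list_eq_iff_nth_eq less_Suc_eq)
  moreover have "{\<omega> \<in> space M. history k \<omega> = h} = {\<omega> \<in> space M. \<forall>j\<in>{..<k}. X j \<omega> \<in> E j}"
    using h by (auto simp: E_def history_event)
  moreover have "{\<omega> \<in> space M. X k \<omega> = a} = {\<omega> \<in> space M. X k \<omega> \<in> E k}"
    by (simp add: E_def)
  ultimately show ?thesis by (simp add: prod)
qed

text \<open>The tower rule for a function of the past and of the next draw.\<close>

lemma expectation_next: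
  fixes f :: "'d list \<Rightarrow> 'd \<Rightarrow> real"
  shows "expectation (\<lambda>\<omega>. f (history k \<omega>) (X k \<omega>))
    = expectation (\<lambda>\<omega>. \<Sum>a\<in>A. prob {\<omega> \<in> space M. X k \<omega> = a} * f (history k \<omega>) a)"
proof -
  let ?H = "history k ` space M"
  have ind: "indicator {\<omega> \<in> space M. P \<omega>} \<omega> = (if P \<omega> then 1 else 0 :: real)" if "\<omega> \<in> space M" for P \<omega>
    using that by simp
  have "expectation (\<lambda>\<omega>. f (history k \<omega>) (X k \<omega>))
      = expectation (\<lambda>\<omega>. \<Sum>h\<in>?H. \<Sum>a\<in>A. f h a * indicator {\<omega> \<in> space M. history k \<omega> = h \<and> X k \<omega> = a} \<omega>)"
  proof (rule Bochner_Integration.integral_cong[OF refl])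
    fix \<omega> assume \<omega>: "\<omega> \<in> space M"
    have "(\<Sum>h\<in>?H. \<Sum>a\<in>A. f h a * indicator {\<omega> \<in> space M. history k \<omega> = h \<and> X k \<omega> = a} \<omega>)
        = (\<Sum>h\<in>?H. \<Sum>a\<in>A. if X k \<omega> = a then (if history k \<omega> = h then f h a else 0) else 0)"
      using \<omega> by (intro sum.cong refl) (simp add: ind)
    also have "\<dots> = f (history k \<omega>) (X k \<omega>)"
      using \<omega> finite_history finite_A draws_in by simp
    finally show "f (history k \<omega>) (X k \<omega>)
      = (\<Sum>h\<in>?H. \<Sum>a\<in>A. f h a * indicator {\<omega> \<in> space M. history k \<omega> = h \<and> X k \<omega> = a} \<omega>)" ..
  qed
  also have "\<dots> = (\<Sum>h\<in>?H. \<Sum>a\<in>A. f h a * prob {\<omega> \<in> space M. history k \<omega> = h \<and> X k \<omega> = a})"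
  proof -
    have [measurable]: "{\<omega> \<in> space M. history k \<omega> = h \<and> X k \<omega> = a} \<in> sets M" for h a
      by (intro sets.sets_Collect_conj history_event_sets draw_event)
    then show ?thesis by (simp add: Bochner_Integration.integral_sum emeasure_eq_measure)
  qed
  also have "\<dots> = (\<Sum>h\<in>?H. \<Sum>a\<in>A. f h a * (prob {\<omega> \<in> space M. history k \<omega> = h} * prob {\<omega> \<in> space M. X k \<omega> = a}))"
    by (intro sum.cong refl, subst prob_history_next) (auto simp: history_def)
  also have "\<dots> = (\<Sum>h\<in>?H. (\<Sum>a\<in>A. prob {\<omega> \<in> space M. X k \<omega> = a} * f h a) * prob {\<omega> \<in> space M. history k \<omega> = h})"
    by (simp add: sum_distrib_left sum_distrib_right mult_ac)
  also have "\<dots> = expectation (\<lambda>\<omega>. \<Sum>h\<in>?H. (\<Sum>a\<in>A. prob {\<omega> \<in> space M. X k \<omega> = a} * f h a)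
       * indicator {\<omega> \<in> space M. history k \<omega> = h} \<omega>)"
    by (simp add: Bochner_Integration.integral_sum emeasure_eq_measure)
  also have "\<dots> = expectation (\<lambda>\<omega>. \<Sum>a\<in>A. prob {\<omega> \<in> space M. X k \<omega> = a} * f (history k \<omega>) a)"
  proof (rule Bochner_Integration.integral_cong[OF refl])
    fix \<omega> assume \<omega>: "\<omega> \<in> space M"
    have "(\<Sum>h\<in>?H. (\<Sum>a\<in>A. prob {\<omega> \<in> space M. X k \<omega> = a} * f h a) * indicator {\<omega> \<in> space M. history k \<omega> = h} \<omega>)
        = (\<Sum>h\<in>?H. if history k \<omega> = h then (\<Sum>a\<in>A. prob {\<omega> \<in> space M. X k \<omega> = a} * f h a) else 0)"
      using \<omega> by (intro sum.cong refl) (simp add: ind)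
    also have "\<dots> = (\<Sum>a\<in>A. prob {\<omega> \<in> space M. X k \<omega> = a} * f (history k \<omega>) a)"
      using \<omega> finite_history by simp
    finally show "(\<Sum>h\<in>?H. (\<Sum>a\<in>A. prob {\<omega> \<in> space M. X k \<omega> = a} * f h a) * indicator {\<omega> \<in> space M. history k \<omega> = h} \<omega>)
      = (\<Sum>a\<in>A. prob {\<omega> \<in> space M. X k \<omega> = a} * f (history k \<omega>) a)" .
  qed
  finally show ?thesis .
qed

end

section \<open>Deterministic inequalities\<close>

text \<open>This is what makes the implicit step a function of its data.\<close>

lemma resolvent_unique:
  assumes T: "monotone_op T" and t: "t > 0" and mem: "a \<in> T u" "a' \<in> T u'"
    and eq: "u + t *\<^sub>R a = u' + t *\<^sub>R a'"
  shows "u = u' \<and> a = a'"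
proof -
  have uu: "u - u' = - (t *\<^sub>R (a - a'))" using eq by (simp add: algebra_simps)
  have "0 \<le> inner (a - a') (u - u')" using T mem unfolding monotone_op_def by blast
  also have "inner (a - a') (u - u') = - (t * (norm (a - a'))\<^sup>2)"
    unfolding uu by (simp add: power2_norm_eq_inner)
  finally have "t * (norm (a - a'))\<^sup>2 \<le> 0" by simp
  then have "a = a'" using t by (simp add: mult_le_0_iff)
  then show ?thesis using eq by simp
qed

text \<open>The descent of the Lyapunov function without noise, with \<open>xp\<close> the distance vector of the iterate
  from the solution, \<open>d\<close> the last step, \<open>F\<close> and \<open>W\<close> the residual with \<open>G\<close> taken at the current and
  at the previous iterate, \<open>r\<close> the shifted distance vector and \<open>y\<close> the lagged one.
  Three sources meet. The weak Minty inequality bounds the product of \<open>F\<close> and \<open>xp\<close>. The remaining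
  product of \<open>F\<close> and \<open>W\<close> is rewritten by polarisation, the Lipschitz condition paying for \<open>F - W\<close> with a
  multiple of the squared norm of \<open>d\<close>. Finally the decrease of the lagged term supplies a negative multiple of
  that same square. The weight \<open>\<mu>\<close> is the one for which all multiples of the squared norm of \<open>W\<close>
  cancel.\<close>

lemma lyapunov_descent:
  fixes F W d y r xp :: "'a::real_inner"
  assumes \<gamma>: "1/2 < \<gamma>" "\<gamma> < 1" and \<eta>: "0 < \<eta>"
    and minty: "inner F xp \<ge> - \<kappa> * (norm F)\<^sup>2"
    and lip: "(norm (F - W))\<^sup>2 \<le> L\<^sup>2 * (norm d)\<^sup>2"
    and y: "(norm y)\<^sup>2 \<ge> (1/2) * (norm d)\<^sup>2 - \<gamma>\<^sup>2 * \<eta>\<^sup>2 * (norm W)\<^sup>2"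
    and r: "r = xp + (\<gamma> * \<eta>) *\<^sub>R W"
  defines "\<mu> \<equiv> (1 - \<gamma>) / (3 * \<gamma> - 1)"
  shows "(norm (r - ((1 - \<gamma>) * \<eta>) *\<^sub>R F))\<^sup>2 + \<mu> * (norm ((\<gamma> * \<eta>) *\<^sub>R W - ((1 - \<gamma>) * \<eta>) *\<^sub>R F))\<^sup>2
    \<le> (norm r)\<^sup>2 + \<mu> * (norm y)\<^sup>2
      - 2 * (1 - \<gamma>) * \<eta> * (\<gamma> * (2 * \<gamma> - 1) * \<eta> / (3 * \<gamma> - 1) - \<kappa>) * (norm F)\<^sup>2
      - (\<mu> / 2 - (1 + \<mu>) * \<gamma> * (1 - \<gamma>) * \<eta>\<^sup>2 * L\<^sup>2) * (norm d)\<^sup>2"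
proof -
  define FF WW FW dd where "FF = (norm F)\<^sup>2" "WW = (norm W)\<^sup>2" "FW = inner F W" "dd = (norm d)\<^sup>2"
  note defs = this
  define \<phi> where "\<phi> = \<gamma> * (2 * \<gamma> - 1) * \<eta> / (3 * \<gamma> - 1)"
  have \<mu>: "0 < \<mu>" "(3 * \<gamma> - 1) * \<mu> = 1 - \<gamma>" using \<gamma> by (auto simp: \<mu>_def)
  have FW: "2 * FW \<ge> FF + WW - L\<^sup>2 * dd"
    using lip by (simp add: defs power2_norm_eq_inner inner_simps inner_commute)
  have e1: "(norm (r - ((1 - \<gamma>) * \<eta>) *\<^sub>R F))\<^sup>2
      = (norm r)\<^sup>2 - 2 * ((1 - \<gamma>) * \<eta>) * inner F r + (1 - \<gamma>)\<^sup>2 * \<eta>\<^sup>2 * FF"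
    unfolding defs power2_norm_eq_inner
    by (simp add: inner_simps inner_commute power2_eq_square algebra_simps)
  have e2: "(norm ((\<gamma> * \<eta>) *\<^sub>R W - ((1 - \<gamma>) * \<eta>) *\<^sub>R F))\<^sup>2
      = \<gamma>\<^sup>2 * \<eta>\<^sup>2 * WW - 2 * \<gamma> * (1 - \<gamma>) * \<eta>\<^sup>2 * FW + (1 - \<gamma>)\<^sup>2 * \<eta>\<^sup>2 * FF"
    unfolding defs power2_norm_eq_inner
    by (simp add: inner_simps inner_commute power2_eq_square algebra_simps)
  have "inner F r = inner F xp + \<gamma> * \<eta> * FW" by (simp add: r defs inner_simps)
  then have Fr: "inner F r \<ge> - \<kappa> * FF + \<gamma> * \<eta> * FW" using minty by (simp add: defs)
  have "2 * ((1 - \<gamma>) * \<eta>) * inner F r \<ge> 2 * ((1 - \<gamma>) * \<eta>) * (- \<kappa> * FF + \<gamma> * \<eta> * FW)"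
    using \<gamma> \<eta> by (intro mult_left_mono Fr) simp
  moreover have "(1 + \<mu>) * (\<gamma> * (1 - \<gamma>) * \<eta>\<^sup>2) * (2 * FW)
      \<ge> (1 + \<mu>) * (\<gamma> * (1 - \<gamma>) * \<eta>\<^sup>2) * (FF + WW - L\<^sup>2 * dd)"
    using \<gamma> \<eta> \<mu> by (intro mult_left_mono FW) simp
  moreover have "\<mu> * (norm y)\<^sup>2 \<ge> \<mu> * ((1/2) * dd - \<gamma>\<^sup>2 * \<eta>\<^sup>2 * WW)"
    using y \<mu> by (intro mult_left_mono) (auto simp: defs)
  moreover have "\<mu> * (\<gamma>\<^sup>2 * \<eta>\<^sup>2) * WW + \<mu> * (\<gamma>\<^sup>2 * \<eta>\<^sup>2) * WW = (1 + \<mu>) * (\<gamma> * (1 - \<gamma>) * \<eta>\<^sup>2) * WW"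
  proof -
    have "2 * \<mu> * \<gamma> = (1 + \<mu>) * (1 - \<gamma>)" using \<mu>(2) by (simp add: algebra_simps)
    then have "(2 * \<mu> * \<gamma>) * (\<gamma> * \<eta>\<^sup>2 * WW) = ((1 + \<mu>) * (1 - \<gamma>)) * (\<gamma> * \<eta>\<^sup>2 * WW)" by simp
    then show ?thesis by (simp add: power2_eq_square mult_ac)
  qed
  moreover have "(1 + \<mu>) * ((1 - \<gamma>)\<^sup>2 * \<eta>\<^sup>2) * FF - (1 + \<mu>) * (\<gamma> * (1 - \<gamma>) * \<eta>\<^sup>2) * FF
      = - 2 * (1 - \<gamma>) * \<eta> * \<phi> * FF"
  proof -
    have "1 + \<mu> = 2 * \<gamma> / (3 * \<gamma> - 1)" using \<gamma> by (simp add: \<mu>_def field_simps)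
    then have "(1 + \<mu>) * ((1 - \<gamma>) * \<eta>\<^sup>2 * FF * (1 - 2 * \<gamma>))
        = 2 * \<gamma> / (3 * \<gamma> - 1) * ((1 - \<gamma>) * \<eta>\<^sup>2 * FF * (1 - 2 * \<gamma>))" by simp
    then show ?thesis by (simp add: \<phi>_def power2_eq_square algebra_simps flip: add_divide_distrib diff_divide_distrib)
  qed
  ultimately show ?thesis
    unfolding e1 e2 unfolding defs[symmetric] \<phi>_def[symmetric] by (simp add: algebra_simps power2_eq_square[of "1 - \<gamma>"] power2_eq_square[of \<gamma>] power2_eq_square[of \<eta>])
qed

text \<open>When the snapshot is kept, the new control variate \<open>a + (D - \<gamma> D')\<close> differs from the old one \<open>a\<close>
  by increments of the component operators. Young's inequality is used with the weight that turns
  the contraction factor \<open>1 - p\<close> into exactly \<open>1 - p / 2\<close>.\<close>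

lemma snapshot_kept_norm_le:
  fixes a D D' :: "'a::real_inner" and p \<gamma> :: real
  assumes p: "0 < p" "p < 1"
  shows "(1 - p) * (norm (a + (D - \<gamma> *\<^sub>R D')))\<^sup>2
    \<le> (1 - p / 2) * (norm a)\<^sup>2
      + 2 * (2 - 3 * p + p\<^sup>2) / p * ((norm D)\<^sup>2 + \<gamma>\<^sup>2 * (norm D')\<^sup>2)"
proof -
  define u where "u = D - \<gamma> *\<^sub>R D'"
  have u: "(norm u)\<^sup>2 \<le> 2 * (norm D)\<^sup>2 + 2 * \<gamma>\<^sup>2 * (norm D')\<^sup>2"
  proof -
    have "0 \<le> (norm (D + \<gamma> *\<^sub>R D'))\<^sup>2" by simp
    then show ?thesis
      unfolding u_def power2_norm_eq_inner
      by (simp add: inner_simps inner_commute power2_eq_square algebra_simps)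
  qed
  have q: "2 - 3 * p + p\<^sup>2 = (1 - p) * (2 - p)" by (simp add: power2_eq_square algebra_simps)
  have "0 \<le> (norm (p *\<^sub>R a - (2 * (1 - p)) *\<^sub>R u))\<^sup>2" by simp
  then have "4 * p * (1 - p) * inner a u \<le> p\<^sup>2 * (norm a)\<^sup>2 + 4 * (1 - p)\<^sup>2 * (norm u)\<^sup>2"
    unfolding power2_norm_eq_inner
    by (simp add: inner_simps inner_commute power2_eq_square algebra_simps)
  then have "2 * (1 - p) * inner a u \<le> p / 2 * (norm a)\<^sup>2 + 2 * (1 - p)\<^sup>2 / p * (norm u)\<^sup>2"
    using p by (simp add: field_simps power2_eq_square)
  moreover have "(1 - p) * (norm (a + u))\<^sup>2
      = (1 - p) * (norm a)\<^sup>2 + 2 * (1 - p) * inner a u + (1 - p) * (norm u)\<^sup>2"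
    by (simp add: power2_norm_eq_inner inner_simps inner_commute algebra_simps)
  ultimately have "(1 - p) * (norm (a + u))\<^sup>2
      \<le> (1 - p / 2) * (norm a)\<^sup>2 + (2 * (1 - p)\<^sup>2 / p + (1 - p)) * (norm u)\<^sup>2"
    by (simp add: algebra_simps)
  also have "2 * (1 - p)\<^sup>2 / p + (1 - p) = (2 - 3 * p + p\<^sup>2) / p"
    using p by (simp add: field_simps power2_eq_square)
  also have "(2 - 3 * p + p\<^sup>2) / p * (norm u)\<^sup>2
      \<le> (2 - 3 * p + p\<^sup>2) / p * (2 * (norm D)\<^sup>2 + 2 * \<gamma>\<^sup>2 * (norm D')\<^sup>2)"
    using p by (intro mult_left_mono u) (simp add: q)
  also have "(2 - 3 * p + p\<^sup>2) / p * (2 * (norm D)\<^sup>2 + 2 * \<gamma>\<^sup>2 * (norm D')\<^sup>2)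
      = 2 * (2 - 3 * p + p\<^sup>2) / p * ((norm D)\<^sup>2 + \<gamma>\<^sup>2 * (norm D')\<^sup>2)"
    using p by (simp add: field_simps)
  finally show ?thesis by (simp add: u_def)
qed

text \<open>The auxiliary claim adds \<open>(1 - \<rho>) V\<^sub>K + C' U\<^sub>K\<close>, the part of the budget that is still to be paid
  at later steps, which makes the induction step an instance of the recursion.\<close>

lemma sum_le_of_contraction:
  fixes V U :: "nat \<Rightarrow> real"
  assumes start: "V 0 = 0" and \<rho>: "\<rho> \<le> 1" and V: "\<And>k. V k \<ge> 0" and U: "\<And>k. U k \<ge> 0"
    and C: "C \<ge> 0"
    and step: "\<And>k. V (Suc k) \<le> (1 - \<rho>) * V k + C * U (Suc k) + C' * U k"
    and C': "C' \<ge> 0"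
  shows "\<rho> * (\<Sum>k\<le>K. V k) \<le> (C + C') * (\<Sum>k\<le>K. U k)"
proof -
  have "\<rho> * (\<Sum>k\<le>K. V k) + (1 - \<rho>) * V K + C' * U K \<le> (C + C') * (\<Sum>k\<le>K. U k)"
  proof (induction K)
    case 0
    then show ?case using start U[of 0] C by (simp add: algebra_simps)
  next
    case (Suc K)
    then show ?case using step[of K] by (simp add: algebra_simps)
  qed
  moreover have "(1 - \<rho>) * V K \<ge> 0" "C' * U K \<ge> 0" using \<rho> V U C' by auto
  ultimately show ?thesis by linarith
qed

section \<open>The constants\<close>

lemma variance_constants_pos:
  fixes p :: real
  assumes "0 < p" "p < 1"
  shows "4 - 6 * p + 3 * p\<^sup>2 > 0" "2 - 3 * p + p\<^sup>2 > 0"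
proof -
  have "4 - 6 * p + 3 * p\<^sup>2 = 1 + 3 * (1 - p)\<^sup>2" "2 - 3 * p + p\<^sup>2 = (1 - p) * (2 - p)"
    by (simp_all add: power2_eq_square algebra_simps)
  moreover have "1 + 3 * (1 - p)\<^sup>2 > 0" "(1 - p) * (2 - p) > 0"
    using assms by (simp_all add: add_pos_nonneg)
  ultimately show "4 - 6 * p + 3 * p\<^sup>2 > 0" "2 - 3 * p + p\<^sup>2 > 0" by (simp_all only:)
qed

text \<open>The constant \<open>M\<close> of the step size against the constant \<open>\<sigma>\<close> of the complexity bound.
  Multiplied by \<open>(1 - \<gamma>) b p\<^sup>2\<close>, \<open>M\<close> is a polynomial in \<open>\<gamma>\<close>, \<open>p\<close> and \<open>b p\<^sup>2\<close>, so that
  \<open>\<sigma>\<^sup>2 t M \<le> 1\<close> follows once \<open>t q1\<close> and \<open>t q2\<close> are bounded by \<open>4 b p\<^sup>2\<close> and \<open>2 b p\<^sup>2\<close>. The first estimate is the general one. The second serves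
  the choice \<open>p = n\<^bsup>-1/3\<^esup>\<close>, where \<open>b p\<^sup>2\<close> may be well below \<open>1\<close> because \<open>b\<close> is rounded down: there
  the lower order terms in \<open>p\<close> not only make up for the rounding of \<open>b\<close>, they leave a factor
  \<open>1 + p\<^sup>2 / 4\<close> to spare.\<close>

lemma M_bounds:
  fixes \<gamma> p bb :: real
  assumes \<gamma>: "1/2 < \<gamma>" "\<gamma> < 1" and p: "0 < p" "p < 1" and b: "0 < bb"
  defines "q1 \<equiv> 4 - 6 * p + 3 * p\<^sup>2" and "q2 \<equiv> 2 - 3 * p + p\<^sup>2"
  defines "M \<equiv> 4 * \<gamma>\<^sup>2 + 4 * \<gamma> / (1 - \<gamma>) * ((q1 / (bb * p) + 2 * \<gamma>\<^sup>2 * q2 / (bb * p)) / (p / 2))"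
  defines "\<sigma> \<equiv> sqrt (1 - \<gamma>) / (2 * sqrt (8 + \<gamma> + 7 * \<gamma>\<^sup>2))"
  shows "M > 0" and "\<sigma> > 0"
    and "bb * p\<^sup>2 \<le> 1 \<Longrightarrow> \<sigma>\<^sup>2 * (bb * p\<^sup>2) * M \<le> 1"
    and "p \<le> 4/5 \<Longrightarrow> bb * p\<^sup>2 \<ge> 1 - p\<^sup>2 \<Longrightarrow> \<sigma>\<^sup>2 * (1 + p\<^sup>2 / 4) * M \<le> 1"
proof -
  have q1: "q1 > 0" and q2: "q2 > 0"
    unfolding q1_def q2_def using variance_constants_pos[OF p] by auto
  show "M > 0" unfolding M_def using q1 q2 \<gamma> p b by (intro add_pos_pos mult_pos_pos divide_pos_pos) auto
  have D: "8 + \<gamma> + 7 * \<gamma>\<^sup>2 > 0" using \<gamma> by (simp add: add_pos_nonneg)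
  show "\<sigma> > 0" unfolding \<sigma>_def using \<gamma> D by simp
  have \<sigma>2: "\<sigma>\<^sup>2 = (1 - \<gamma>) / (4 * (8 + \<gamma> + 7 * \<gamma>\<^sup>2))"
    unfolding \<sigma>_def using \<gamma> D by (simp add: power_divide power_mult_distrib)
  have M: "(1 - \<gamma>) * (bb * p\<^sup>2) * M = 4 * (\<gamma>\<^sup>2 * (1 - \<gamma>) * (bb * p\<^sup>2) + 2 * \<gamma> * q1 + 4 * \<gamma> ^ 3 * q2)"
    unfolding M_def using \<gamma> p b
    by (simp add: field_simps power2_eq_square power3_eq_cube)
  \<comment> \<open>The first three terms on the right absorb the three summands of \<open>M\<close>.\<close>
  have gap: "8 + \<gamma> + 7 * \<gamma>\<^sup>2 = 8 * \<gamma>\<^sup>2 * (1 - \<gamma>) + 8 * \<gamma> + 8 * \<gamma> ^ 3 + (1 - \<gamma>) * (8 + \<gamma>)"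
    by (simp add: power2_eq_square power3_eq_cube algebra_simps)
  have rest: "(1 - \<gamma>) * (8 + \<gamma>) \<ge> 0" using \<gamma> by simp
  have core: "\<sigma>\<^sup>2 * t * M \<le> 1"
    if t: "0 \<le> t" "t * q1 \<le> 4 * (bb * p\<^sup>2)" "t * q2 \<le> 2 * (bb * p\<^sup>2)" "t \<le> 8" for t
  proof -
    have bp: "bb * p\<^sup>2 > 0" using b p by simp
    have "t * ((1 - \<gamma>) * (bb * p\<^sup>2) * M)
        = 4 * (\<gamma>\<^sup>2 * (1 - \<gamma>) * (bb * p\<^sup>2) * t + 2 * \<gamma> * (t * q1) + 4 * \<gamma> ^ 3 * (t * q2))"
      unfolding M by (simp add: algebra_simps)
    also have "\<dots> \<le> 4 * (\<gamma>\<^sup>2 * (1 - \<gamma>) * (bb * p\<^sup>2) * 8 + 2 * \<gamma> * (4 * (bb * p\<^sup>2)) + 4 * \<gamma> ^ 3 * (2 * (bb * p\<^sup>2)))"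
      using \<gamma> bp t by (intro mult_left_mono add_mono) auto
    also have "\<dots> = 4 * (bb * p\<^sup>2) * (8 * \<gamma>\<^sup>2 * (1 - \<gamma>) + 8 * \<gamma> + 8 * \<gamma> ^ 3)"
      by (simp add: algebra_simps)
    also have "\<dots> \<le> 4 * (bb * p\<^sup>2) * (8 + \<gamma> + 7 * \<gamma>\<^sup>2)"
      using bp rest gap by (intro mult_left_mono) auto
    finally have "(bb * p\<^sup>2) * (t * ((1 - \<gamma>) * M)) \<le> (bb * p\<^sup>2) * (4 * (8 + \<gamma> + 7 * \<gamma>\<^sup>2))"
      by (simp only: mult_ac)
    then have "t * ((1 - \<gamma>) * M) \<le> 4 * (8 + \<gamma> + 7 * \<gamma>\<^sup>2)" using bp by (rule mult_left_le_imp_le)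
    then show ?thesis unfolding \<sigma>2 using D by (simp add: divide_le_eq mult_ac)
  qed
  show "\<sigma>\<^sup>2 * (bb * p\<^sup>2) * M \<le> 1" if bp: "bb * p\<^sup>2 \<le> 1"
  proof (rule core)
    have "p * p \<le> p" using p by (simp add: mult_le_one)
    then have "q1 \<le> 4" "q2 \<le> 2" using p unfolding q1_def q2_def power2_eq_square by linarith+
    then show "bb * p\<^sup>2 * q1 \<le> 4 * (bb * p\<^sup>2)" "bb * p\<^sup>2 * q2 \<le> 2 * (bb * p\<^sup>2)" using b p by auto
  qed (use bp b p in auto)
  show "\<sigma>\<^sup>2 * (1 + p\<^sup>2 / 4) * M \<le> 1" if p45: "p \<le> 4/5" and bp: "bb * p\<^sup>2 \<ge> 1 - p\<^sup>2"
  proof (rule core)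
    have p2: "p\<^sup>2 \<le> 16/25" "p ^ 3 \<le> 64/125" "p ^ 3 \<le> p\<^sup>2"
      using p p45 power_mono[of p "4/5" 2] power_mono[of p "4/5" 3] power_decreasing[of 2 3 p]
      by (simp_all add: power_divide)
    have "8 * p - 3/2 * p\<^sup>2 \<le> 136/25"
    proof -
      have "0 \<le> (4/5 - p) * (8 - 3/2 * (4/5 + p))" using p p45 by (intro mult_nonneg_nonneg) auto
      also have "(4/5 - p) * (8 - 3/2 * (4/5 + p)) = 136/25 - (8 * p - 3/2 * p\<^sup>2)"
        by (simp add: power2_eq_square field_simps)
      finally show ?thesis by simp
    qed
    then have "0 \<le> p * (6 - 8 * p + 3/2 * p\<^sup>2 - 3/4 * p ^ 3)"
      using p p2 by (intro mult_nonneg_nonneg) linarith+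
    moreover have "4 * (1 - p\<^sup>2) - (1 + p\<^sup>2 / 4) * q1 = p * (6 - 8 * p + 3/2 * p\<^sup>2 - 3/4 * p ^ 3)"
      by (simp add: q1_def power2_eq_square power3_eq_cube field_simps)
    ultimately have "0 \<le> 4 * (1 - p\<^sup>2) - (1 + p\<^sup>2 / 4) * q1" by (simp only:)
    then have "(1 + p\<^sup>2 / 4) * q1 \<le> 4 * (1 - p\<^sup>2)" by (simp only: diff_ge_0_iff_ge)
    also have "\<dots> \<le> 4 * (bb * p\<^sup>2)" using bp by simp
    finally show "(1 + p\<^sup>2 / 4) * q1 \<le> 4 * (bb * p\<^sup>2)" .
    have "0 \<le> p * (3 - 7/2 * p + 3/4 * p\<^sup>2 - p ^ 3 / 4)"
      using p p45 p2 zero_le_power2[of p] by (intro mult_nonneg_nonneg) linarith+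
    moreover have "2 * (1 - p\<^sup>2) - (1 + p\<^sup>2 / 4) * q2 = p * (3 - 7/2 * p + 3/4 * p\<^sup>2 - p ^ 3 / 4)"
      by (simp add: q2_def power2_eq_square power3_eq_cube field_simps)
    ultimately have "0 \<le> 2 * (1 - p\<^sup>2) - (1 + p\<^sup>2 / 4) * q2" by (simp only:)
    then have "(1 + p\<^sup>2 / 4) * q2 \<le> 2 * (1 - p\<^sup>2)" by (simp only: diff_ge_0_iff_ge)
    also have "\<dots> \<le> 2 * (bb * p\<^sup>2)" using bp by simp
    finally show "(1 + p\<^sup>2 / 4) * q2 \<le> 2 * (bb * p\<^sup>2)" .
    show "1 + p\<^sup>2 / 4 \<le> 8" using p2 by linarith
  qed simp
qed

text \<open>Here \<open>Q'\<close> is the number of iterations needed, \<open>Q\<close> the larger number that is budgeted, and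
  \<open>s = n\<^bsup>2/3\<^esup>\<close> is not an integer in general. A budget of \<open>\<lfloor>4 Q s\<rfloor>\<close> may lose almost one evaluation to
  rounding. The factor \<open>1 + p\<^sup>2 / 4\<close> between \<open>Q'\<close> and \<open>Q\<close> is just enough, since
  \<open>4 s \<cdot> p\<^sup>2 / 4 = 1\<close> gives back one evaluation per iteration. It is essential to stop after the least
  sufficient number of iterations, not after \<open>\<lfloor>Q\<rfloor>\<close>.\<close>

lemma iteration_count:
  fixes Q Q' s p m :: real
  assumes s: "s * p\<^sup>2 = 1" "0 < s" and m: "m \<le> s" and Q': "0 \<le> Q'" "Q' * (1 + p\<^sup>2 / 4) \<le> Q"
  obtains K :: nat where "Q' \<le> real K + 1" and "real K * (3 * m + s) \<le> of_int \<lfloor>4 * Q * s\<rfloor>"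
    and "int K \<le> \<lfloor>Q\<rfloor>"
proof
  \<comment> \<open>Truncated subtraction: for \<open>Q' = 0\<close> no iteration is made.\<close>
  define K where "K = nat \<lceil>Q'\<rceil> - 1"
  show "Q' \<le> real K + 1" unfolding K_def using Q' by linarith
  have QQ: "Q' \<le> Q" using Q' mult_left_mono[of 1 "1 + p\<^sup>2 / 4" Q'] by simp
  have Q: "0 \<le> Q" using QQ Q' by simp
  have K: "real K \<le> Q'" unfolding K_def using Q' by linarith
  then show "int K \<le> \<lfloor>Q\<rfloor>" using QQ by (simp add: le_floor_iff)
  show "real K * (3 * m + s) \<le> of_int \<lfloor>4 * Q * s\<rfloor>"
  proof (cases "K = 0")
    case False
    have "real K * (3 * m + s) + 1 \<le> real K * (4 * s) + real K"
      using False m by (intro add_mono mult_left_mono) auto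
    also have "\<dots> = 4 * (real K * (1 + p\<^sup>2 / 4)) * s" using s by (simp add: algebra_simps)
    also have "\<dots> \<le> 4 * (Q' * (1 + p\<^sup>2 / 4)) * s"
      using s K by (intro mult_right_mono mult_left_mono) (auto simp: add_nonneg_nonneg)
    also have "\<dots> \<le> 4 * Q * s" using s Q' by simp
    finally show ?thesis by linarith
  qed (use Q s in simp)
qed

section \<open>The estimator and its sampling\<close>

text \<open>The quantity whose batch mean enters the estimator. It vanishes when the three points coincide,
  and its mean square over the components controls the variance of the estimator.\<close>

definition control_variate ::
  "(nat \<Rightarrow> 'a \<Rightarrow> 'a::real_vector) \<Rightarrow> real \<Rightarrow> 'a \<Rightarrow> 'a \<Rightarrow> 'a \<Rightarrow> nat \<Rightarrow> 'a" where
  "control_variate Gs \<gamma> w x x' i = Gs i x - \<gamma> *\<^sub>R Gs i x' - (1 - \<gamma>) *\<^sub>R Gs i w"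

text \<open>The estimator is the exact reflected direction plus a pure sampling error.\<close>

lemma lsvrg_estimator_eq:
  "lsvrg_estimator Gs n \<gamma> S w x x' = batch_mean Gs {1..n} x - \<gamma> *\<^sub>R batch_mean Gs {1..n} x'
     + batch_error {1..n} (control_variate Gs \<gamma> w x x') S"
proof -
  have mean: "(1 / real (card Q)) *\<^sub>R (\<Sum>i\<in>Q. control_variate Gs \<gamma> w x x' i)
      = batch_mean Gs Q x - \<gamma> *\<^sub>R batch_mean Gs Q x' - (1 - \<gamma>) *\<^sub>R batch_mean Gs Q w" for Q
    by (simp add: control_variate_def batch_mean_def sum_subtractf scaleR_right.sum[symmetric]
        scaleR_diff_right)
  show ?thesis unfolding lsvrg_estimator_def batch_error_def mean by (simp add: algebra_simps)
qed

context lsvrg_sampling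
begin

lemma batch_in: "\<omega> \<in> space \<Omega> \<Longrightarrow> B k \<omega> \<in> batches {1..n} b"
  unfolding batches_def using batch[of \<omega> k] by blast

sublocale draws: finite_draws \<Omega> "\<lambda>k \<omega>. (B k \<omega>, c k \<omega>)" "batches {1..n} b \<times> UNIV"
proof unfold_locales
  show "finite (batches {1..n} b \<times> (UNIV :: bool set))" by (simp add: finite_batches)
  show "(B k \<omega>, c k \<omega>) \<in> batches {1..n} b \<times> UNIV" if "\<omega> \<in> space \<Omega>" for k \<omega>
    using batch_in[OF that] by simp
qed (rule indep)

lemma measurable_draw: "(\<lambda>\<omega>. (B k \<omega>, c k \<omega>)) \<in> measurable \<Omega> (count_space UNIV)"
  using indep unfolding indep_vars_def by blast

lemma prob_draw:
  assumes b: "b \<le> n" and p: "0 \<le> p" "p \<le> 1" and S: "S \<in> batches {1..n} b"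
  shows "prob {\<omega> \<in> space \<Omega>. (B k \<omega>, c k \<omega>) = (S, t)}
    = (if t then p else 1 - p) / real (card (batches {1..n} b))"
proof -
  have "{\<omega> \<in> space \<Omega>. (B k \<omega>, c k \<omega>) = (S, t)} = (\<lambda>\<omega>. (B k \<omega>, c k \<omega>)) -` {(S, t)} \<inter> space \<Omega>"
    by auto
  then have "prob {\<omega> \<in> space \<Omega>. (B k \<omega>, c k \<omega>) = (S, t)}
      = measure (distr \<Omega> (count_space UNIV) (\<lambda>\<omega>. (B k \<omega>, c k \<omega>))) {(S, t)}"
    by (simp add: measure_distr[OF measurable_draw])
  also have "\<dots> = pmf (pair_pmf (pmf_of_set (batches {1..n} b)) (bernoulli_pmf p)) (S, t)"
    unfolding law batches_def by (simp add: pmf.rep_eq)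
  also have "\<dots> = pmf (pmf_of_set (batches {1..n} b)) S * pmf (bernoulli_pmf p) t"
    by (rule pmf_pair)
  also have "pmf (pmf_of_set (batches {1..n} b)) S = 1 / real (card (batches {1..n} b))"
    using S by (subst pmf_of_set) (auto simp: finite_batches)
  also have "pmf (bernoulli_pmf p) t = (if t then p else 1 - p)"
    using p by (cases t) auto
  finally show ?thesis by simp
qed

end

section \<open>Expected descent along a run\<close>

text \<open>A run of the algorithm with an arbitrary step size, which is the setting of the variance
  estimates. The weak Minty solution and the bound on the step size enter with the descent.\<close>

locale lsvrg_run = lsvrg_sampling \<Omega> n b p B c
  for \<Omega> :: "'w measure" and n b :: nat and p :: real
    and B :: "nat \<Rightarrow> 'w \<Rightarrow> nat set" and c :: "nat \<Rightarrow> 'w \<Rightarrow> bool" +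
  fixes Gs :: "nat \<Rightarrow> 'a \<Rightarrow> 'a::real_inner" and T :: "'a \<Rightarrow> 'a set"
    and L \<gamma> \<eta> :: real and x0 v0 :: 'a and x v w :: "nat \<Rightarrow> 'w \<Rightarrow> 'a"
  assumes T_mono: "monotone_op T"
    and Lipschitz: "\<And>x y. (1 / real n) * (\<Sum>i=1..n. (norm (Gs i x - Gs i y))\<^sup>2) \<le> L\<^sup>2 * (norm (x - y))\<^sup>2"
    and gamma: "1/2 < \<gamma>" "\<gamma> < 1" and eta: "0 < \<eta>"
    and b: "0 < b" "b \<le> n" and p: "0 < p" "p < 1"
    and v0: "v0 \<in> T x0"
    and init: "\<And>\<omega>. \<omega> \<in> space \<Omega> \<Longrightarrow> x 0 \<omega> = x0 \<and> v 0 \<omega> = v0 \<and> w 0 \<omega> = x0"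
    and x_step: "\<And>k \<omega>. \<omega> \<in> space \<Omega> \<Longrightarrow>
           x (k + 1) \<omega> = x k \<omega>
             - \<eta> *\<^sub>R lsvrg_estimator Gs n \<gamma> (B k \<omega>) (w k \<omega>) (x k \<omega>) (x (k - 1) \<omega>)
             - \<eta> *\<^sub>R (\<gamma> *\<^sub>R v (k + 1) \<omega> - (2 * \<gamma> - 1) *\<^sub>R v k \<omega>)"
    and v_step: "\<And>k \<omega>. \<omega> \<in> space \<Omega> \<Longrightarrow> v (k + 1) \<omega> \<in> T (x (k + 1) \<omega>)"
    and w_step: "\<And>k \<omega>. \<omega> \<in> space \<Omega> \<Longrightarrow> w (k + 1) \<omega> = (if c k \<omega> then x k \<omega> else w k \<omega>)"
begin

lemma card_batches_pos: "real (card (batches {1..n} b)) > 0"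
  using b card_batches[of "{1..n}" b] zero_less_binomial[of b n] by simp

lemma expectation_batch:
  fixes f :: "(nat set \<times> bool) list \<Rightarrow> nat set \<Rightarrow> real"
  shows "expectation (\<lambda>\<omega>. f (draws.history k \<omega>) (B k \<omega>))
    = expectation (\<lambda>\<omega>. (\<Sum>S\<in>batches {1..n} b. f (draws.history k \<omega>) S) / real (card (batches {1..n} b)))"
proof -
  have "expectation (\<lambda>\<omega>. f (draws.history k \<omega>) (B k \<omega>))
      = expectation (\<lambda>\<omega>. \<Sum>a\<in>batches {1..n} b \<times> UNIV.
          prob {\<omega> \<in> space \<Omega>. (B k \<omega>, c k \<omega>) = a} * f (draws.history k \<omega>) (fst a))"
    using draws.expectation_next[of "\<lambda>h a. f h (fst a)" k] by simp
  also have "\<dots> = expectation (\<lambda>\<omega>. (\<Sum>S\<in>batches {1..n} b. f (draws.history k \<omega>) S) / real (card (batches {1..n} b)))"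
  proof (intro Bochner_Integration.integral_cong refl)
    fix \<omega>
    show "(\<Sum>a\<in>batches {1..n} b \<times> UNIV. prob {\<omega> \<in> space \<Omega>. (B k \<omega>, c k \<omega>) = a} * f (draws.history k \<omega>) (fst a))
      = (\<Sum>S\<in>batches {1..n} b. f (draws.history k \<omega>) S) / real (card (batches {1..n} b))"
      unfolding sum.cartesian_product' sum_divide_distrib using b p
      by (intro sum.cong refl) (simp add: prob_draw UNIV_bool diff_divide_distrib algebra_simps del: prod.inject)
  qed
  finally show ?thesis .
qed

text \<open>The next iterate depends on the batch of the current iteration but not on its coin, so the coin
  has to be averaged out separately.\<close>

lemma expectation_coin:
  fixes f :: "(nat set \<times> bool) list \<Rightarrow> nat set \<Rightarrow> bool \<Rightarrow> real"
  shows "expectation (\<lambda>\<omega>. f (draws.history k \<omega>) (B k \<omega>) (c k \<omega>))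
    = expectation (\<lambda>\<omega>. p * f (draws.history k \<omega>) (B k \<omega>) True + (1 - p) * f (draws.history k \<omega>) (B k \<omega>) False)"
proof -
  have "expectation (\<lambda>\<omega>. f (draws.history k \<omega>) (B k \<omega>) (c k \<omega>))
      = expectation (\<lambda>\<omega>. \<Sum>a\<in>batches {1..n} b \<times> UNIV.
          prob {\<omega> \<in> space \<Omega>. (B k \<omega>, c k \<omega>) = a} * f (draws.history k \<omega>) (fst a) (snd a))"
    using draws.expectation_next[of "\<lambda>h a. f h (fst a) (snd a)" k] by simp
  also have "\<dots> = expectation (\<lambda>\<omega>. (\<Sum>S\<in>batches {1..n} b.
      p * f (draws.history k \<omega>) S True + (1 - p) * f (draws.history k \<omega>) S False) / real (card (batches {1..n} b)))"
  proof (intro Bochner_Integration.integral_cong refl)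
    fix \<omega>
    show "(\<Sum>a\<in>batches {1..n} b \<times> UNIV. prob {\<omega> \<in> space \<Omega>. (B k \<omega>, c k \<omega>) = a}
        * f (draws.history k \<omega>) (fst a) (snd a))
      = (\<Sum>S\<in>batches {1..n} b. p * f (draws.history k \<omega>) S True + (1 - p) * f (draws.history k \<omega>) S False)
        / real (card (batches {1..n} b))"
      unfolding sum.cartesian_product' sum_divide_distrib using b p
      by (intro sum.cong refl) (simp add: prob_draw UNIV_bool add_divide_distrib del: prod.inject)
  qed
  also have "\<dots> = expectation (\<lambda>\<omega>. p * f (draws.history k \<omega>) (B k \<omega>) True + (1 - p) * f (draws.history k \<omega>) (B k \<omega>) False)"
    by (rule expectation_batch[symmetric])
  finally show ?thesis .
qed

lemma expectation_refresh: "expectation (\<lambda>\<omega>. if c k \<omega> then 1 else 0) = p"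
proof -
  have "expectation (\<lambda>\<omega>. if c k \<omega> then 1 else 0) = expectation (\<lambda>_. p)"
    using expectation_coin[of "\<lambda>h S t. if t then 1 else 0" k]
    by (simp only: if_True if_False mult_1_right mult_zero_right add_0_right)
  then show ?thesis by (simp only: lebesgue_integral_const prob_space) simp
qed

lemma next_iterate_eq:
  assumes "\<omega> \<in> space \<Omega>" "\<omega>' \<in> space \<Omega>"
    and prev: "x i \<omega> = x i \<omega>'" "v i \<omega> = v i \<omega>'" "w i \<omega> = w i \<omega>'" "x (i - 1) \<omega> = x (i - 1) \<omega>'"
    and draw: "B i \<omega> = B i \<omega>'"
  shows "x (Suc i) \<omega> = x (Suc i) \<omega>' \<and> v (Suc i) \<omega> = v (Suc i) \<omega>'"
proof (rule resolvent_unique[OF T_mono, of "\<eta> * \<gamma>"])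
  have eq: "x (Suc i) y + (\<eta> * \<gamma>) *\<^sub>R v (Suc i) y
      = x i y - \<eta> *\<^sub>R lsvrg_estimator Gs n \<gamma> (B i y) (w i y) (x i y) (x (i - 1) y)
        + (\<eta> * (2 * \<gamma> - 1)) *\<^sub>R v i y" if "y \<in> space \<Omega>" for y
    using x_step[OF that, of i] by (simp add: algebra_simps)
  show "x (Suc i) \<omega> + (\<eta> * \<gamma>) *\<^sub>R v (Suc i) \<omega> = x (Suc i) \<omega>' + (\<eta> * \<gamma>) *\<^sub>R v (Suc i) \<omega>'"
    unfolding eq[OF assms(1)] eq[OF assms(2)] prev draw by simp
qed (use v_step[of _ i] assms(1,2) eta gamma in auto)

text \<open>All indices up to \<open>k\<close> are treated together because a step refers to the last two iterates.\<close>

lemma state_determined: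
  assumes "\<omega> \<in> space \<Omega>" "\<omega>' \<in> space \<Omega>"
  shows "j \<le> k \<Longrightarrow> draws.history k \<omega> = draws.history k \<omega>' \<Longrightarrow>
    x j \<omega> = x j \<omega>' \<and> v j \<omega> = v j \<omega>' \<and> w j \<omega> = w j \<omega>'"
proof (induction j rule: less_induct)
  case (less j)
  show ?case
  proof (cases j)
    case 0
    then show ?thesis using init assms by simp
  next
    case (Suc i)
    have prev: "x i \<omega> = x i \<omega>'" "v i \<omega> = v i \<omega>'" "w i \<omega> = w i \<omega>'" "x (i - 1) \<omega> = x (i - 1) \<omega>'"
      using less Suc by auto
    have draw: "B i \<omega> = B i \<omega>'" "c i \<omega> = c i \<omega>'"
      using less.prems Suc by (auto simp: draws.history_eq_iff)
    have "w (Suc i) \<omega> = w (Suc i) \<omega>'"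
      using w_step[OF assms(1), of i] w_step[OF assms(2), of i] prev draw by simp
    then show ?thesis using Suc next_iterate_eq[OF assms prev draw(1)] by simp
  qed
qed

abbreviation G :: "'a \<Rightarrow> 'a" where "G \<equiv> batch_mean Gs {1..n}"

text \<open>The quantities of the Lyapunov analysis are the residual \<open>F\<close>, the residual \<open>W\<close> with \<open>G\<close> lagging
  behind by one step, the last step \<open>d\<close>, the shifted iterate \<open>z\<close> and the difference \<open>lag\<close> between \<open>z\<close>
  and the previous iterate. At \<open>k = 0\<close> the last is set to zero: the inequality required of it in
  \<open>lyapunov_descent\<close> still holds there, and the initial value of the Lyapunov function becomes small
  enough for the constant in the final bound.\<close>

definition F :: "nat \<Rightarrow> 'w \<Rightarrow> 'a" where "F k \<omega> = G (x k \<omega>) + v k \<omega>"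
definition W :: "nat \<Rightarrow> 'w \<Rightarrow> 'a" where "W k \<omega> = G (x (k - 1) \<omega>) + v k \<omega>"
definition d :: "nat \<Rightarrow> 'w \<Rightarrow> 'a" where "d k \<omega> = x k \<omega> - x (k - 1) \<omega>"
definition z :: "nat \<Rightarrow> 'w \<Rightarrow> 'a" where "z k \<omega> = x k \<omega> + (\<gamma> * \<eta>) *\<^sub>R W k \<omega>"
definition lag :: "nat \<Rightarrow> 'w \<Rightarrow> 'a" where "lag k \<omega> = (if k = 0 then 0 else d k \<omega> + (\<gamma> * \<eta>) *\<^sub>R W k \<omega>)"
definition xi :: "nat \<Rightarrow> 'w \<Rightarrow> nat \<Rightarrow> 'a" where
  "xi k \<omega> = control_variate Gs \<gamma> (w k \<omega>) (x k \<omega>) (x (k - 1) \<omega>)"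
definition err :: "nat \<Rightarrow> 'w \<Rightarrow> 'a" where "err k \<omega> = batch_error {1..n} (xi k \<omega>) (B k \<omega>)"
definition xi_mean_sq :: "nat \<Rightarrow> 'w \<Rightarrow> real" where
  "xi_mean_sq k \<omega> = (1 / (real n * real b)) * (\<Sum>i=1..n. (norm (xi k \<omega> i))\<^sup>2)"

lemma determined:
  assumes "\<omega> \<in> space \<Omega>" "\<omega>' \<in> space \<Omega>" "draws.history k \<omega> = draws.history k \<omega>'"
  shows "F k \<omega> = F k \<omega>'" "W k \<omega> = W k \<omega>'" "d k \<omega> = d k \<omega>'" "z k \<omega> = z k \<omega>'" "lag k \<omega> = lag k \<omega>'"
    "xi k \<omega> = xi k \<omega>'" "xi_mean_sq k \<omega> = xi_mean_sq k \<omega>'"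
proof -
  have "x k \<omega> = x k \<omega>'" "v k \<omega> = v k \<omega>'" "w k \<omega> = w k \<omega>'" "x (k - 1) \<omega> = x (k - 1) \<omega>'"
    using state_determined[OF assms(1,2) order_refl assms(3)]
      state_determined[OF assms(1,2) diff_le_self assms(3)] by blast+
  then show "F k \<omega> = F k \<omega>'" "W k \<omega> = W k \<omega>'" "d k \<omega> = d k \<omega>'" "z k \<omega> = z k \<omega>'" "lag k \<omega> = lag k \<omega>'"
    "xi k \<omega> = xi k \<omega>'" "xi_mean_sq k \<omega> = xi_mean_sq k \<omega>'"
    by (simp_all only: F_def W_def d_def z_def lag_def xi_mean_sq_def xi_def)
qed

lemma err_determined:
  assumes "\<omega> \<in> space \<Omega>" "\<omega>' \<in> space \<Omega>" "draws.history (Suc k) \<omega> = draws.history (Suc k) \<omega>'"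
  shows "err k \<omega> = err k \<omega>'"
  using assms determined(6)[OF assms(1,2), of k] unfolding err_def by (simp add: draws.history_eq_iff)

lemma integrable_iterates:
  shows "integrable \<Omega> (\<lambda>\<omega>. (norm (F k \<omega>))\<^sup>2)" "integrable \<Omega> (\<lambda>\<omega>. (norm (d k \<omega>))\<^sup>2)"
    "integrable \<Omega> (\<lambda>\<omega>. (norm (z k \<omega> - y))\<^sup>2)" "integrable \<Omega> (\<lambda>\<omega>. (norm (lag k \<omega>))\<^sup>2)"
    "integrable \<Omega> (xi_mean_sq k)" "integrable \<Omega> (\<lambda>\<omega>. (norm (err k \<omega>))\<^sup>2)"
proof -
  show "integrable \<Omega> (\<lambda>\<omega>. (norm (F k \<omega>))\<^sup>2)"
    by (rule draws.integrable_determined[of k]) (drule (2) determined(1), simp)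
  show "integrable \<Omega> (\<lambda>\<omega>. (norm (d k \<omega>))\<^sup>2)"
    by (rule draws.integrable_determined[of k]) (drule (2) determined(3), simp)
  show "integrable \<Omega> (\<lambda>\<omega>. (norm (z k \<omega> - y))\<^sup>2)"
    by (rule draws.integrable_determined[of k]) (drule (2) determined(4), simp)
  show "integrable \<Omega> (\<lambda>\<omega>. (norm (lag k \<omega>))\<^sup>2)"
    by (rule draws.integrable_determined[of k]) (drule (2) determined(5), simp)
  show "integrable \<Omega> (xi_mean_sq k)"
    by (rule draws.integrable_determined[of k]) (rule determined(7))
  show "integrable \<Omega> (\<lambda>\<omega>. (norm (err k \<omega>))\<^sup>2)"
    by (rule draws.integrable_determined[of "Suc k"]) (drule (2) err_determined, simp)
qed

text \<open>The shift by \<open>\<gamma>\<eta>W\<close> absorbs both the reflection term and the implicit term, so that the shifted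
  iterate moves by an explicit step along the residual, perturbed by the sampling error.\<close>

lemma z_step:
  assumes "\<omega> \<in> space \<Omega>"
  shows "z (Suc k) \<omega> = z k \<omega> - ((1 - \<gamma>) * \<eta>) *\<^sub>R F k \<omega> - \<eta> *\<^sub>R err k \<omega>"
  using x_step[OF assms, of k] unfolding lsvrg_estimator_eq
  by (simp add: z_def W_def F_def err_def xi_def algebra_simps) (simp flip: scaleR_left_distrib)

lemma lag_step:
  assumes "\<omega> \<in> space \<Omega>"
  shows "lag (Suc k) \<omega> = (\<gamma> * \<eta>) *\<^sub>R W k \<omega> - ((1 - \<gamma>) * \<eta>) *\<^sub>R F k \<omega> - \<eta> *\<^sub>R err k \<omega>"
proof -
  have "lag (Suc k) \<omega> = z (Suc k) \<omega> - x k \<omega>" by (simp add: lag_def d_def z_def)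
  then show ?thesis unfolding z_step[OF assms] by (simp add: z_def)
qed

text \<open>Given the past, the sampling error has mean zero, and its second moment is bounded by the mean
  square of the control variate.\<close>

lemma expectation_noise:
  fixes u :: "'w \<Rightarrow> 'a"
  assumes u: "\<And>\<omega> \<omega>'. \<omega> \<in> space \<Omega> \<Longrightarrow> \<omega>' \<in> space \<Omega> \<Longrightarrow>
    draws.history k \<omega> = draws.history k \<omega>' \<Longrightarrow> u \<omega> = u \<omega>'"
  shows "expectation (\<lambda>\<omega>. (norm (u \<omega> - \<eta> *\<^sub>R err k \<omega>))\<^sup>2)
    = expectation (\<lambda>\<omega>. (norm (u \<omega>))\<^sup>2) + \<eta>\<^sup>2 * expectation (\<lambda>\<omega>. (norm (err k \<omega>))\<^sup>2)"
    and "expectation (\<lambda>\<omega>. (norm (err k \<omega>))\<^sup>2) \<le> expectation (xi_mean_sq k)"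
proof -
  let ?N = "real (card (batches {1..n} b))"
  let ?var = "\<lambda>\<omega>. (\<Sum>S\<in>batches {1..n} b. (norm (batch_error {1..n} (xi k \<omega>) S))\<^sup>2) / ?N"
  obtain g where g: "\<And>\<omega>. \<omega> \<in> space \<Omega> \<Longrightarrow> (u \<omega>, xi k \<omega>) = g (draws.history k \<omega>)"
    by (rule factor_through[of "space \<Omega>" "draws.history k" "\<lambda>\<omega>. (u \<omega>, xi k \<omega>)"])
      (auto dest: u determined(6))
  have g': "u \<omega> = fst (g (draws.history k \<omega>))" "xi k \<omega> = snd (g (draws.history k \<omega>))"
    if "\<omega> \<in> space \<Omega>" for \<omega> using g[OF that, symmetric] by simp_all
  have var: "expectation (\<lambda>\<omega>. (norm (err k \<omega>))\<^sup>2) = expectation ?var"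
    using expectation_batch[of "\<lambda>h S. (norm (batch_error {1..n} (snd (g h)) S))\<^sup>2" k]
    by (simp add: err_def g' cong: Bochner_Integration.integral_cong)
  have int_var: "integrable \<Omega> ?var"
    by (rule draws.integrable_determined[of k]) (drule (2) determined(6), simp)
  have int_u: "integrable \<Omega> (\<lambda>\<omega>. (norm (u \<omega>))\<^sup>2)"
    by (rule draws.integrable_determined[of k]) (drule (2) u, simp)
  have "expectation (\<lambda>\<omega>. (norm (u \<omega> - \<eta> *\<^sub>R err k \<omega>))\<^sup>2)
      = expectation (\<lambda>\<omega>. (\<Sum>S\<in>batches {1..n} b. (norm (u \<omega> - \<eta> *\<^sub>R batch_error {1..n} (xi k \<omega>) S))\<^sup>2) / ?N)"
    using expectation_batch[of "\<lambda>h S. (norm (fst (g h) - \<eta> *\<^sub>R batch_error {1..n} (snd (g h)) S))\<^sup>2" k]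
    by (simp add: err_def g' cong: Bochner_Integration.integral_cong)
  also have "\<dots> = expectation (\<lambda>\<omega>. (norm (u \<omega>))\<^sup>2 + \<eta>\<^sup>2 * ?var \<omega>)"
  proof (intro Bochner_Integration.integral_cong refl)
    fix \<omega>
    have ne: "batches {1..n} b \<noteq> {}" using card_batches_pos by auto
    have cen: "(\<Sum>S\<in>batches {1..n} b. batch_error {1..n} (xi k \<omega>) S) = 0"
      using b by (intro sum_batch_error) auto
    show "(\<Sum>S\<in>batches {1..n} b. (norm (u \<omega> - \<eta> *\<^sub>R batch_error {1..n} (xi k \<omega>) S))\<^sup>2) / ?N
        = (norm (u \<omega>))\<^sup>2 + \<eta>\<^sup>2 * ?var \<omega>"
      by (intro mean_norm_shifted ne cen finite_batches finite_atLeastAtMost)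
  qed
  also have "\<dots> = expectation (\<lambda>\<omega>. (norm (u \<omega>))\<^sup>2) + \<eta>\<^sup>2 * expectation ?var"
    by (subst Bochner_Integration.integral_add[OF int_u integrable_mult_right[OF int_var]])
      (simp only: integral_mult_right_zero)
  finally show "expectation (\<lambda>\<omega>. (norm (u \<omega> - \<eta> *\<^sub>R err k \<omega>))\<^sup>2)
    = expectation (\<lambda>\<omega>. (norm (u \<omega>))\<^sup>2) + \<eta>\<^sup>2 * expectation (\<lambda>\<omega>. (norm (err k \<omega>))\<^sup>2)"
    by (simp only: var)
  show "expectation (\<lambda>\<omega>. (norm (err k \<omega>))\<^sup>2) \<le> expectation (xi_mean_sq k)"
    unfolding var
  proof (intro integral_mono int_var integrable_iterates)
    fix \<omega>
    show "?var \<omega> \<le> xi_mean_sq k \<omega>"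
      using mean_norm_batch_error_le[of "{1..n}" b "xi k \<omega>"] b by (simp add: xi_mean_sq_def)
  qed
qed

lemma G_Lipschitz: "(norm (G y - G y'))\<^sup>2 \<le> L\<^sup>2 * (norm (y - y'))\<^sup>2"
proof -
  have "G y - G y' = (1 / real (card {1..n})) *\<^sub>R (\<Sum>i=1..n. Gs i y - Gs i y')"
    by (simp add: batch_mean_def sum_subtractf scaleR_diff_right)
  then have "(norm (G y - G y'))\<^sup>2 \<le> (1 / real n) * (\<Sum>i=1..n. (norm (Gs i y - Gs i y'))\<^sup>2)"
    using norm_mean_le[of "{1..n}" "\<lambda>i. Gs i y - Gs i y'"] by simp
  then show ?thesis using Lipschitz[of y y'] by linarith
qed

definition C_now :: real where "C_now = (4 - 6 * p + 3 * p\<^sup>2) / (real b * p)"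
definition C_prev :: real where "C_prev = 2 * \<gamma>\<^sup>2 * (2 - 3 * p + p\<^sup>2) / (real b * p)"

text \<open>If the coin refreshes the snapshot, the control variate forgets its past and reduces to a single
  increment of the component operators. Otherwise \<open>snapshot_kept_norm_le\<close> applies. Averaging over the
  coin, which is independent of the new iterate, and using the Lipschitz condition on the increments
  gives a contraction by \<open>1 - p / 2\<close> with the two constants above.\<close>

lemma xi_mean_sq_step:
  "expectation (xi_mean_sq (Suc k)) \<le> (1 - p / 2) * expectation (xi_mean_sq k)
    + C_now * L\<^sup>2 * expectation (\<lambda>\<omega>. (norm (d (Suc k) \<omega>))\<^sup>2)
    + C_prev * L\<^sup>2 * expectation (\<lambda>\<omega>. (norm (d k \<omega>))\<^sup>2)"
proof -
  define D where "D k \<omega> i = Gs i (x k \<omega>) - Gs i (x (k - 1) \<omega>)" for k \<omega> i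
  define ms where "ms f = (1 / (real n * real b)) * (\<Sum>i=1..n. (norm (f i :: 'a))\<^sup>2)" for f
  \<comment> \<open>the next control variate as a function of the outcome of the coin\<close>
  define nxt where "nxt \<omega> t = (\<lambda>i. if t then D (Suc k) \<omega> i else xi k \<omega> i + (D (Suc k) \<omega> i - \<gamma> *\<^sub>R D k \<omega> i))" for \<omega> t
  have xi_Suc: "xi (Suc k) \<omega> = nxt \<omega> (c k \<omega>)" if "\<omega> \<in> space \<Omega>" for \<omega>
    using w_step[OF that, of k]
    by (auto simp: nxt_def D_def xi_def control_variate_def algebra_simps fun_eq_iff)
  have nxt_eq: "nxt \<omega> = nxt \<omega>'"
    if \<omega>: "\<omega> \<in> space \<Omega>" "\<omega>' \<in> space \<Omega>"
      and eq: "(draws.history k \<omega>, B k \<omega>) = (draws.history k \<omega>', B k \<omega>')" for \<omega> \<omega>'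
  proof -
    have hist: "draws.history k \<omega> = draws.history k \<omega>'" and Beq: "B k \<omega> = B k \<omega>'" using eq by auto
    have now: "x k \<omega> = x k \<omega>'" "v k \<omega> = v k \<omega>'" "w k \<omega> = w k \<omega>'" "x (k - 1) \<omega> = x (k - 1) \<omega>'"
      using state_determined[OF \<omega> _ hist, of k] state_determined[OF \<omega> _ hist, of "k - 1"] by simp_all
    have D: "D k \<omega> = D k \<omega>'" "D (Suc k) \<omega> = D (Suc k) \<omega>'"
      using now next_iterate_eq[OF \<omega> now Beq] unfolding D_def by (simp_all add: fun_eq_iff)
    show ?thesis unfolding nxt_def D determined(6)[OF \<omega> hist] ..
  qed
  obtain g where g: "\<And>\<omega>. \<omega> \<in> space \<Omega> \<Longrightarrow> nxt \<omega> = g (draws.history k \<omega>, B k \<omega>)"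
    using factor_through[of "space \<Omega>" "\<lambda>\<omega>. (draws.history k \<omega>, B k \<omega>)" nxt, OF nxt_eq] by blast
  let ?avg = "\<lambda>\<omega>. p * ms (nxt \<omega> True) + (1 - p) * ms (nxt \<omega> False)"
  have "expectation (xi_mean_sq (Suc k)) = expectation (\<lambda>\<omega>. ms (g (draws.history k \<omega>, B k \<omega>) (c k \<omega>)))"
    by (intro Bochner_Integration.integral_cong refl) (simp add: xi_mean_sq_def xi_Suc ms_def g)
  also have "\<dots> = expectation ?avg"
    unfolding expectation_coin[of "\<lambda>h S t. ms (g (h, S) t)" k]
    by (intro Bochner_Integration.integral_cong refl) (simp add: g)
  also have "\<dots> \<le> expectation (\<lambda>\<omega>. (1 - p / 2) * xi_mean_sq k \<omega>
      + C_now * L\<^sup>2 * (norm (d (Suc k) \<omega>))\<^sup>2 + C_prev * L\<^sup>2 * (norm (d k \<omega>))\<^sup>2)"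
  proof (rule integral_mono)
    show "integrable \<Omega> ?avg"
    proof (rule draws.integrable_determined[of "Suc k"])
      fix \<omega> \<omega>' assume "\<omega> \<in> space \<Omega>" "\<omega>' \<in> space \<Omega>" "draws.history (Suc k) \<omega> = draws.history (Suc k) \<omega>'"
      then have "nxt \<omega> = nxt \<omega>'" by (intro nxt_eq) (auto simp: draws.history_eq_iff)
      then show "?avg \<omega> = ?avg \<omega>'" by simp
    qed
    show "integrable \<Omega> (\<lambda>\<omega>. (1 - p / 2) * xi_mean_sq k \<omega>
      + C_now * L\<^sup>2 * (norm (d (Suc k) \<omega>))\<^sup>2 + C_prev * L\<^sup>2 * (norm (d k \<omega>))\<^sup>2)"
      by (intro Bochner_Integration.integrable_add integrable_mult_right integrable_iterates)
    fix \<omega>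
    let ?q = "2 - 3 * p + p\<^sup>2"
    have nb: "0 \<le> 1 / (real n * real b)" by simp
    have Lip: "(1 / (real n * real b)) * (\<Sum>i=1..n. (norm (D j \<omega> i))\<^sup>2) \<le> L\<^sup>2 * (norm (d j \<omega>))\<^sup>2 / real b" for j
      using divide_right_mono[OF Lipschitz[of "x j \<omega>" "x (j - 1) \<omega>"], of "real b"]
      by (simp add: D_def d_def)
    have q: "?q \<ge> 0" and q1: "4 - 6 * p + 3 * p\<^sup>2 \<ge> 0"
      using variance_constants_pos[OF p] by simp_all
    have one: "p * (norm (nxt \<omega> True i))\<^sup>2 + (1 - p) * (norm (nxt \<omega> False i))\<^sup>2
        \<le> (1 - p / 2) * (norm (xi k \<omega> i))\<^sup>2 + (4 - 6 * p + 3 * p\<^sup>2) / p * (norm (D (Suc k) \<omega> i))\<^sup>2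
          + 2 * \<gamma>\<^sup>2 * ?q / p * (norm (D k \<omega> i))\<^sup>2" for i
    proof -
      have "(4 - 6 * p + 3 * p\<^sup>2) / p = p + 2 * ?q / p"
        using p by (simp add: field_simps power2_eq_square)
      then have "(4 - 6 * p + 3 * p\<^sup>2) / p * (norm (D (Suc k) \<omega> i))\<^sup>2
          = p * (norm (D (Suc k) \<omega> i))\<^sup>2 + 2 * ?q / p * (norm (D (Suc k) \<omega> i))\<^sup>2"
        by (simp only: distrib_right)
      moreover have "2 * ?q / p * ((norm (D (Suc k) \<omega> i))\<^sup>2 + \<gamma>\<^sup>2 * (norm (D k \<omega> i))\<^sup>2)
          = 2 * ?q / p * (norm (D (Suc k) \<omega> i))\<^sup>2 + 2 * \<gamma>\<^sup>2 * ?q / p * (norm (D k \<omega> i))\<^sup>2"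
        unfolding distrib_left using p by (simp add: field_simps)
      moreover note snapshot_kept_norm_le[OF p, of "xi k \<omega> i" "D (Suc k) \<omega> i" \<gamma> "D k \<omega> i"]
      ultimately show ?thesis unfolding nxt_def if_True if_False simp_thms by linarith
    qed
    have "?avg \<omega> = (1 / (real n * real b)) * (\<Sum>i=1..n. p * (norm (nxt \<omega> True i))\<^sup>2 + (1 - p) * (norm (nxt \<omega> False i))\<^sup>2)"
      unfolding ms_def sum.distrib sum_distrib_left[symmetric] by (simp add: algebra_simps add_divide_distrib diff_divide_distrib)
    also have "\<dots> \<le> (1 / (real n * real b)) * (\<Sum>i=1..n. (1 - p / 2) * (norm (xi k \<omega> i))\<^sup>2
        + (4 - 6 * p + 3 * p\<^sup>2) / p * (norm (D (Suc k) \<omega> i))\<^sup>2 + 2 * \<gamma>\<^sup>2 * ?q / p * (norm (D k \<omega> i))\<^sup>2)"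
      by (intro mult_left_mono sum_mono one nb)
    also have "\<dots> = (1 - p / 2) * xi_mean_sq k \<omega>
        + (4 - 6 * p + 3 * p\<^sup>2) / p * ((1 / (real n * real b)) * (\<Sum>i=1..n. (norm (D (Suc k) \<omega> i))\<^sup>2))
        + 2 * \<gamma>\<^sup>2 * ?q / p * ((1 / (real n * real b)) * (\<Sum>i=1..n. (norm (D k \<omega> i))\<^sup>2))"
      unfolding xi_mean_sq_def sum.distrib sum_distrib_left[symmetric] distrib_left by (simp only: mult.left_commute)
    also have "\<dots> \<le> (1 - p / 2) * xi_mean_sq k \<omega>
        + (4 - 6 * p + 3 * p\<^sup>2) / p * (L\<^sup>2 * (norm (d (Suc k) \<omega>))\<^sup>2 / real b)
        + 2 * \<gamma>\<^sup>2 * ?q / p * (L\<^sup>2 * (norm (d k \<omega>))\<^sup>2 / real b)"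
      using p q q1 by (intro add_mono mult_left_mono Lip order_refl) auto
    also have "\<dots> = (1 - p / 2) * xi_mean_sq k \<omega>
      + C_now * L\<^sup>2 * (norm (d (Suc k) \<omega>))\<^sup>2 + C_prev * L\<^sup>2 * (norm (d k \<omega>))\<^sup>2"
      unfolding C_now_def C_prev_def by (simp add: mult_ac)
    finally show "?avg \<omega> \<le> (1 - p / 2) * xi_mean_sq k \<omega>
      + C_now * L\<^sup>2 * (norm (d (Suc k) \<omega>))\<^sup>2 + C_prev * L\<^sup>2 * (norm (d k \<omega>))\<^sup>2" .
  qed
  also have "\<dots> = (1 - p / 2) * expectation (xi_mean_sq k)
    + C_now * L\<^sup>2 * expectation (\<lambda>\<omega>. (norm (d (Suc k) \<omega>))\<^sup>2)
    + C_prev * L\<^sup>2 * expectation (\<lambda>\<omega>. (norm (d k \<omega>))\<^sup>2)"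
    using integrable_iterates by simp
  finally show ?thesis .
qed

lemma C_nonneg: "C_now \<ge> 0" "C_prev \<ge> 0"
  unfolding C_now_def C_prev_def using p variance_constants_pos[OF p] by simp_all

text \<open>The recursion starts at zero, because initially the snapshot and both iterates coincide.\<close>

lemma sum_err_le:
  "(\<Sum>k\<le>K. expectation (\<lambda>\<omega>. (norm (err k \<omega>))\<^sup>2))
    \<le> (C_now + C_prev) / (p / 2) * L\<^sup>2 * (\<Sum>k\<le>K. expectation (\<lambda>\<omega>. (norm (d k \<omega>))\<^sup>2))"
proof -
  have "(\<Sum>k\<le>K. expectation (\<lambda>\<omega>. (norm (err k \<omega>))\<^sup>2)) \<le> (\<Sum>k\<le>K. expectation (xi_mean_sq k))"
    by (intro sum_mono expectation_noise(2)[of _ "\<lambda>_. 0"]) simp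
  moreover have "(p / 2) * (\<Sum>k\<le>K. expectation (xi_mean_sq k))
      \<le> (C_now * L\<^sup>2 + C_prev * L\<^sup>2) * (\<Sum>k\<le>K. expectation (\<lambda>\<omega>. (norm (d k \<omega>))\<^sup>2))"
  proof (rule sum_le_of_contraction)
    have "xi 0 \<omega> i = 0" if "\<omega> \<in> space \<Omega>" for \<omega> i
      using init[OF that] by (simp add: xi_def control_variate_def algebra_simps)
    then have "expectation (xi_mean_sq 0) = expectation (\<lambda>_. 0)"
      by (intro Bochner_Integration.integral_cong refl) (simp add: xi_mean_sq_def)
    then show "expectation (xi_mean_sq 0) = 0" by simp
    show "expectation (xi_mean_sq k) \<ge> 0" for k
      by (intro Bochner_Integration.integral_nonneg) (auto simp: xi_mean_sq_def sum_nonneg)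
  qed (use p C_nonneg xi_mean_sq_step in \<open>auto intro: Bochner_Integration.integral_nonneg\<close>)
  ultimately have "(p / 2) * (\<Sum>k\<le>K. expectation (\<lambda>\<omega>. (norm (err k \<omega>))\<^sup>2))
      \<le> (C_now * L\<^sup>2 + C_prev * L\<^sup>2) * (\<Sum>k\<le>K. expectation (\<lambda>\<omega>. (norm (d k \<omega>))\<^sup>2))"
    using p mult_left_mono[of _ _ "p / 2"] by (meson half_gt_zero less_imp_le order_trans)
  then show ?thesis using p by (simp add: field_simps)
qed

lemma expectation_component_evals:
  "expectation (\<lambda>\<omega>. real (component_evals n b (\<lambda>k. c k \<omega>) K)) = real n + real K * (3 * real b + real n * p)"
proof -
  have int: "integrable \<Omega> (\<lambda>\<omega>. if c k \<omega> then 1 else 0 :: real)" for k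
    by (rule draws.integrable_determined[of "Suc k"]) (simp add: draws.history_eq_iff)
  have "expectation (\<lambda>\<omega>. real (component_evals n b (\<lambda>k. c k \<omega>) K))
      = expectation (\<lambda>\<omega>. real n + (\<Sum>k<K. 3 * real b + real n * (if c k \<omega> then 1 else 0)))"
    unfolding component_evals_def
    by (intro Bochner_Integration.integral_cong refl) (auto intro!: sum.cong)
  also have "\<dots> = real n + (\<Sum>k<K. 3 * real b + real n * p)"
    using int by (simp add: expectation_refresh prob_space)
  finally show ?thesis by simp
qed

lemma v_in_T: "\<omega> \<in> space \<Omega> \<Longrightarrow> v k \<omega> \<in> T (x k \<omega>)"
  using init v0 v_step by (cases k) auto

text \<open>Summing the descent, the noise costs a multiple of the summed squared steps. The condition on the
  step size says precisely that the negative multiple of the same sum left over by the descent pays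
  for it.\<close>

lemma residual_sum_le:
  assumes minty: "\<And>y u. y \<in> op_dom T \<Longrightarrow> u \<in> T y \<Longrightarrow>
      inner (G y + u) (y - xs) \<ge> - \<kappa> * (norm (G y + u))\<^sup>2"
    and step_size: "\<eta>\<^sup>2 * L\<^sup>2 * (4 * \<gamma>\<^sup>2 + 4 * \<gamma> / (1 - \<gamma>) * ((C_now + C_prev) / (p / 2))) \<le> 1"
  shows "2 * (1 - \<gamma>) * \<eta> * (\<gamma> * (2 * \<gamma> - 1) * \<eta> / (3 * \<gamma> - 1) - \<kappa>)
      * (\<Sum>k\<le>K. expectation (\<lambda>\<omega>. (norm (F k \<omega>))\<^sup>2))
    \<le> (norm (x0 + (\<gamma> * \<eta>) *\<^sub>R (G x0 + v0) - xs))\<^sup>2"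
proof -
  define \<mu> where "\<mu> = (1 - \<gamma>) / (3 * \<gamma> - 1)"
  define a where "a = 2 * (1 - \<gamma>) * \<eta> * (\<gamma> * (2 * \<gamma> - 1) * \<eta> / (3 * \<gamma> - 1) - \<kappa>)"
  define q where "q = \<mu> / 2 - (1 + \<mu>) * \<gamma> * (1 - \<gamma>) * \<eta>\<^sup>2 * L\<^sup>2"
  define EF where "EF k = expectation (\<lambda>\<omega>. (norm (F k \<omega>))\<^sup>2)" for k
  define Ed where "Ed k = expectation (\<lambda>\<omega>. (norm (d k \<omega>))\<^sup>2)" for k
  define Ee where "Ee k = expectation (\<lambda>\<omega>. (norm (err k \<omega>))\<^sup>2)" for k
  define P where "P k = expectation (\<lambda>\<omega>. (norm (z k \<omega> - xs))\<^sup>2) + \<mu> * expectation (\<lambda>\<omega>. (norm (lag k \<omega>))\<^sup>2)" for k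
  have \<mu>: "\<mu> > 0" using gamma by (simp add: \<mu>_def)
  have descent: "P (Suc k) \<le> P k - a * EF k - q * Ed k + (1 + \<mu>) * \<eta>\<^sup>2 * Ee k" for k
  proof -
    define r where "r \<omega> = z k \<omega> - xs - ((1 - \<gamma>) * \<eta>) *\<^sub>R F k \<omega>" for \<omega>
    define s where "s \<omega> = (\<gamma> * \<eta>) *\<^sub>R W k \<omega> - ((1 - \<gamma>) * \<eta>) *\<^sub>R F k \<omega>" for \<omega>
    have det: "r \<omega> = r \<omega>'" "s \<omega> = s \<omega>'"
      if "\<omega> \<in> space \<Omega>" "\<omega>' \<in> space \<Omega>" "draws.history k \<omega> = draws.history k \<omega>'" for \<omega> \<omega>'
      unfolding r_def s_def determined(1,2,4)[OF that] by (rule refl)+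
    have int: "integrable \<Omega> (\<lambda>\<omega>. (norm (r \<omega>))\<^sup>2)" "integrable \<Omega> (\<lambda>\<omega>. (norm (s \<omega>))\<^sup>2)"
      by (rule draws.integrable_determined[of k], drule (2) det(1), simp only:)
         (rule draws.integrable_determined[of k], drule (2) det(2), simp only:)
    have "expectation (\<lambda>\<omega>. (norm (z (Suc k) \<omega> - xs))\<^sup>2) = expectation (\<lambda>\<omega>. (norm (r \<omega> - \<eta> *\<^sub>R err k \<omega>))\<^sup>2)"
      by (intro Bochner_Integration.integral_cong refl) (simp add: z_step r_def algebra_simps)
    then have z: "expectation (\<lambda>\<omega>. (norm (z (Suc k) \<omega> - xs))\<^sup>2) = expectation (\<lambda>\<omega>. (norm (r \<omega>))\<^sup>2) + \<eta>\<^sup>2 * Ee k"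
      by (simp only: expectation_noise(1)[of k r, OF det(1)] Ee_def)
    have "expectation (\<lambda>\<omega>. (norm (lag (Suc k) \<omega>))\<^sup>2) = expectation (\<lambda>\<omega>. (norm (s \<omega> - \<eta> *\<^sub>R err k \<omega>))\<^sup>2)"
      by (intro Bochner_Integration.integral_cong refl) (simp add: lag_step s_def)
    then have lag: "expectation (\<lambda>\<omega>. (norm (lag (Suc k) \<omega>))\<^sup>2) = expectation (\<lambda>\<omega>. (norm (s \<omega>))\<^sup>2) + \<eta>\<^sup>2 * Ee k"
      by (simp only: expectation_noise(1)[of k s, OF det(2)] Ee_def)
    have "expectation (\<lambda>\<omega>. (norm (r \<omega>))\<^sup>2 + \<mu> * (norm (s \<omega>))\<^sup>2)
        \<le> expectation (\<lambda>\<omega>. (norm (z k \<omega> - xs))\<^sup>2 + \<mu> * (norm (lag k \<omega>))\<^sup>2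
            - a * (norm (F k \<omega>))\<^sup>2 - q * (norm (d k \<omega>))\<^sup>2)"
    proof (rule integral_mono)
      fix \<omega> assume \<omega>: "\<omega> \<in> space \<Omega>"
      have T: "v k \<omega> \<in> T (x k \<omega>)" using v_in_T[OF \<omega>] .
      show "(norm (r \<omega>))\<^sup>2 + \<mu> * (norm (s \<omega>))\<^sup>2 \<le> (norm (z k \<omega> - xs))\<^sup>2 + \<mu> * (norm (lag k \<omega>))\<^sup>2
            - a * (norm (F k \<omega>))\<^sup>2 - q * (norm (d k \<omega>))\<^sup>2"
        unfolding r_def s_def a_def q_def \<mu>_def
      proof (rule lyapunov_descent[OF gamma eta])
        show "- \<kappa> * (norm (F k \<omega>))\<^sup>2 \<le> inner (F k \<omega>) (x k \<omega> - xs)"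
          using minty[of "x k \<omega>" "v k \<omega>"] T by (auto simp: F_def op_dom_def)
        show "(norm (F k \<omega> - W k \<omega>))\<^sup>2 \<le> L\<^sup>2 * (norm (d k \<omega>))\<^sup>2"
          using G_Lipschitz[of "x k \<omega>" "x (k - 1) \<omega>"] by (simp add: F_def W_def d_def)
        show "z k \<omega> - xs = x k \<omega> - xs + (\<gamma> * \<eta>) *\<^sub>R W k \<omega>" by (simp add: z_def)
        show "1 / 2 * (norm (d k \<omega>))\<^sup>2 - \<gamma>\<^sup>2 * \<eta>\<^sup>2 * (norm (W k \<omega>))\<^sup>2 \<le> (norm (lag k \<omega>))\<^sup>2"
        proof (cases "k = 0")
          case True
          \<comment> \<open>the first step is zero, since the iterate before the first one is the first one\<close>
          then show ?thesis by (simp add: lag_def d_def)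
        next
          case False
          have "0 \<le> (norm (d k \<omega> + (2 * \<gamma> * \<eta>) *\<^sub>R W k \<omega>))\<^sup>2" by simp
          then show ?thesis using False unfolding lag_def power2_norm_eq_inner
            by (simp add: inner_simps inner_commute power2_eq_square algebra_simps)
        qed
      qed
    qed (intro Bochner_Integration.integrable_add Bochner_Integration.integrable_diff
        integrable_mult_right int integrable_iterates)+
    then have "expectation (\<lambda>\<omega>. (norm (r \<omega>))\<^sup>2) + \<mu> * expectation (\<lambda>\<omega>. (norm (s \<omega>))\<^sup>2)
        \<le> P k - a * EF k - q * Ed k"
      using int integrable_iterates by (simp add: P_def EF_def Ed_def)
    then show ?thesis unfolding P_def[of "Suc k"] z lag by (simp add: algebra_simps)
  qed
  have tele: "a * (\<Sum>k\<le>K. EF k) + q * (\<Sum>k\<le>K. Ed k) \<le> P 0 - P (Suc K) + (1 + \<mu>) * \<eta>\<^sup>2 * (\<Sum>k\<le>K. Ee k)"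
  proof (induction K)
    case 0
    then show ?case using descent[of 0] by simp
  next
    case (Suc K)
    then show ?case using descent[of "Suc K"] by (simp add: distrib_left)
  qed
  have P0: "P 0 = (norm (x0 + (\<gamma> * \<eta>) *\<^sub>R (G x0 + v0) - xs))\<^sup>2"
  proof -
    have "P 0 = expectation (\<lambda>\<omega>. (norm (x0 + (\<gamma> * \<eta>) *\<^sub>R (G x0 + v0) - xs))\<^sup>2)"
      unfolding P_def lag_def by (simp add: z_def W_def init cong: Bochner_Integration.integral_cong)
    then show ?thesis by (simp add: prob_space)
  qed
  have PK: "P (Suc K) \<ge> 0" unfolding P_def using \<mu> by (intro add_nonneg_nonneg mult_nonneg_nonneg Bochner_Integration.integral_nonneg) auto
  define S where "S = (C_now + C_prev) / (p / 2)"
  have noise: "(1 + \<mu>) * \<eta>\<^sup>2 * (\<Sum>k\<le>K. Ee k) \<le> (1 + \<mu>) * \<eta>\<^sup>2 * (S * L\<^sup>2 * (\<Sum>k\<le>K. Ed k))"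
    using \<mu> unfolding S_def Ee_def Ed_def by (intro mult_left_mono sum_err_le) auto
  have "(3 * \<gamma> - 1) * (q - (1 + \<mu>) * \<eta>\<^sup>2 * (S * L\<^sup>2))
      = (1 - \<gamma>) / 2 * (1 - \<eta>\<^sup>2 * L\<^sup>2 * (4 * \<gamma>\<^sup>2 + 4 * \<gamma> / (1 - \<gamma>) * S))"
  proof -
    have "(3 * \<gamma> - 1) * \<mu> = 1 - \<gamma>" "(3 * \<gamma> - 1) * (1 + \<mu>) = 2 * \<gamma>"
      using gamma by (auto simp: \<mu>_def field_simps)
    moreover have "(3 * \<gamma> - 1) * (q - (1 + \<mu>) * \<eta>\<^sup>2 * (S * L\<^sup>2))
        = ((3 * \<gamma> - 1) * \<mu>) / 2 - ((3 * \<gamma> - 1) * (1 + \<mu>)) * (\<eta>\<^sup>2 * L\<^sup>2 * (\<gamma> * (1 - \<gamma>) + S))"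
      unfolding q_def by (simp add: field_simps)
    ultimately have "(3 * \<gamma> - 1) * (q - (1 + \<mu>) * \<eta>\<^sup>2 * (S * L\<^sup>2))
        = (1 - \<gamma>) / 2 - 2 * \<gamma> * (\<eta>\<^sup>2 * L\<^sup>2 * (\<gamma> * (1 - \<gamma>) + S))" by simp
    also have "\<dots> = (1 - \<gamma>) / 2 * (1 - \<eta>\<^sup>2 * L\<^sup>2 * (4 * \<gamma>\<^sup>2 + 4 * \<gamma> / (1 - \<gamma>) * S))"
      using gamma by (simp add: field_simps power2_eq_square)
    finally show ?thesis .
  qed
  also have "\<dots> \<ge> 0" using step_size gamma unfolding S_def[symmetric] by simp
  finally have "q - (1 + \<mu>) * \<eta>\<^sup>2 * (S * L\<^sup>2) \<ge> 0" using gamma by (simp add: zero_le_mult_iff)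
  moreover have "(\<Sum>k\<le>K. Ed k) \<ge> 0" unfolding Ed_def by (intro sum_nonneg Bochner_Integration.integral_nonneg) simp
  ultimately have "(q - (1 + \<mu>) * \<eta>\<^sup>2 * (S * L\<^sup>2)) * (\<Sum>k\<le>K. Ed k) \<ge> 0" by simp
  then show ?thesis using tele noise P0 PK unfolding a_def[symmetric] EF_def[symmetric] by (simp add: algebra_simps)
qed

end

section \<open>Convergence rate and evaluation complexity\<close>

theorem corollary4p2:
  fixes Gs :: "nat \<Rightarrow> real ^ 'p \<Rightarrow> real ^ 'p" and G :: "real ^ 'p \<Rightarrow> real ^ 'p"
    and T :: "real ^ 'p \<Rightarrow> (real ^ 'p) set"
    and n b :: nat
    and p L \<kappa> \<gamma> \<rho> C Chat M \<delta> \<eta> \<sigma> R2 \<Theta> \<Gamma> :: real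
    and xstar x0 v0 :: "real ^ 'p"
    and \<Omega> :: "'w measure" and B :: "nat \<Rightarrow> 'w \<Rightarrow> nat set" and c :: "nat \<Rightarrow> 'w \<Rightarrow> bool"
    and x v w :: "nat \<Rightarrow> 'w \<Rightarrow> real ^ 'p"
  assumes G_def: "G = batch_mean Gs {1..n}"
    and solvable: "zeros_of_sum G T \<noteq> {}"
    and maxmono: "maximally_monotone T"
    and L_pos: "L > 0"
    and Lipschitz: "\<And>x y. (1 / real n) * (\<Sum>i=1..n. (norm (Gs i x - Gs i y))\<^sup>2) \<le> L\<^sup>2 * (norm (x - y))\<^sup>2"
    and xstar: "xstar \<in> zeros_of_sum G T"
    and kappa_nonneg: "\<kappa> \<ge> 0"
    and weak_Minty: "\<And>x v. x \<in> op_dom T \<Longrightarrow> v \<in> T x \<Longrightarrow>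
           inner (G x + v) (x - xstar) \<ge> - \<kappa> * (norm (G x + v))\<^sup>2"
    and gamma: "\<gamma> \<in> {1/2<..<1}"
    and b: "b \<in> {1..n}"
    and p: "p \<in> {0<..<1}"
    and bp: "real b * p\<^sup>2 \<le> 1"
    and rho_def: "\<rho> = p / 2"
    and C_def: "C = (4 - 6 * p + 3 * p\<^sup>2) / (real b * p)"
    and Chat_def: "Chat = 2 * \<gamma>\<^sup>2 * (2 - 3 * p + p\<^sup>2) / (real b * p)"
    and M_def: "M = 4 * \<gamma>\<^sup>2 + 4 * \<gamma> / (1 - \<gamma>) * ((C + Chat) / \<rho>)"
    and delta_def: "\<delta> = \<gamma> * (2 * \<gamma> - 1) / ((3 * \<gamma> - 1) * sqrt M)"
    and kappa_small: "L * \<kappa> < \<delta>"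
    and eta_def: "\<eta> = 1 / (L * sqrt M)"
    and sigma_def: "\<sigma> = sqrt (1 - \<gamma>) / (2 * sqrt (8 + \<gamma> + 7 * \<gamma>\<^sup>2))"
    and R2_def: "R2 = (norm (x0 - xstar))\<^sup>2 + \<gamma>\<^sup>2 * \<eta>\<^sup>2 * (norm (G x0 + v0))\<^sup>2"
    and Theta_def: "\<Theta> = (3 * \<gamma> - 1) * \<eta> / ((1 - \<gamma>) * (\<gamma> * (2 * \<gamma> - 1) * \<eta> - (3 * \<gamma> - 1) * \<kappa>))"
    and Gamma_def: "\<Gamma> = \<Theta> / \<sigma>\<^sup>2"
    and x0_dom: "x0 \<in> op_dom T"
    and v0_in: "v0 \<in> T x0"
    and sampling: "lsvrg_sampling \<Omega> n b p B c"
    and init: "\<And>\<omega>. \<omega> \<in> space \<Omega> \<Longrightarrow> x 0 \<omega> = x0 \<and> v 0 \<omega> = v0 \<and> w 0 \<omega> = x0"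
    and x_step: "\<And>k \<omega>. \<omega> \<in> space \<Omega> \<Longrightarrow>
           x (k + 1) \<omega> = x k \<omega>
             \<comment> \<open>truncated subtraction on nat: for \<open>k = 0\<close>, \<open>x (k - 1)\<close> is \<open>x 0\<close>, as \<open>x\<close> at index -1 should be\<close>
             - \<eta> *\<^sub>R lsvrg_estimator Gs n \<gamma> (B k \<omega>) (w k \<omega>) (x k \<omega>) (x (k - 1) \<omega>)
             - \<eta> *\<^sub>R (\<gamma> *\<^sub>R v (k + 1) \<omega> - (2 * \<gamma> - 1) *\<^sub>R v k \<omega>)"
    and v_step: "\<And>k \<omega>. \<omega> \<in> space \<Omega> \<Longrightarrow> v (k + 1) \<omega> \<in> T (x (k + 1) \<omega>)"
    and w_step: "\<And>k \<omega>. \<omega> \<in> space \<Omega> \<Longrightarrow> w (k + 1) \<omega> = (if c k \<omega> then x k \<omega> else w k \<omega>)"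
  shows "\<eta> \<ge> \<sigma> * sqrt (real b) * p / L
    \<and> (\<forall>K. 1 / (real K + 1) * (\<Sum>k=0..K. integral\<^sup>L \<Omega> (\<lambda>\<omega>. (norm (G (x k \<omega>) + v k \<omega>))\<^sup>2))
             \<le> \<Theta> * L\<^sup>2 * R2 / (\<sigma>\<^sup>2 * real b * p\<^sup>2 * (real K + 1)))
    \<and> (\<forall>\<epsilon>>0. n \<ge> 2 \<longrightarrow> p = real n powr (- 1 / 3) \<longrightarrow> b = nat \<lfloor>real n powr (2 / 3)\<rfloor> \<longrightarrow>
        (\<exists>K. 1 / (real K + 1) * (\<Sum>k=0..K. integral\<^sup>L \<Omega> (\<lambda>\<omega>. (norm (G (x k \<omega>) + v k \<omega>))\<^sup>2)) \<le> \<epsilon>\<^sup>2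
           \<and> integral\<^sup>L \<Omega> (\<lambda>\<omega>. real (component_evals n b (\<lambda>k. c k \<omega>) K))
               \<le> real n + of_int \<lfloor>4 * \<Gamma> * L\<^sup>2 * R2 * real n powr (2 / 3) / \<epsilon>\<^sup>2\<rfloor>
           \<and> int (resolvent_evals K) \<le> \<lfloor>\<Gamma> * L\<^sup>2 * R2 / \<epsilon>\<^sup>2\<rfloor>))"
proof -
  interpret lsvrg_sampling \<Omega> n b p B c by (rule sampling)
  have \<gamma>: "1/2 < \<gamma>" "\<gamma> < 1" and p': "0 < p" "p < 1" and b': "0 < b" "b \<le> n" and b0: "0 < real b"
    using gamma p b by auto
  have M_eq: "M = 4 * \<gamma>\<^sup>2 + 4 * \<gamma> / (1 - \<gamma>) * (((4 - 6 * p + 3 * p\<^sup>2) / (real b * p)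
      + 2 * \<gamma>\<^sup>2 * (2 - 3 * p + p\<^sup>2) / (real b * p)) / (p / 2))"
    unfolding M_def C_def Chat_def rho_def ..
  note bounds = M_bounds[OF \<gamma> p' b0, folded M_eq sigma_def]
  have M: "M > 0" and \<sigma>: "\<sigma> > 0" by (fact bounds)+
  have \<eta>: "\<eta> > 0" unfolding eta_def using M L_pos by simp
  have \<eta>_sq: "\<eta>\<^sup>2 * L\<^sup>2 * M = 1"
    unfolding eta_def using M L_pos by (simp add: power_divide power_mult_distrib)
  interpret lsvrg_run \<Omega> n b p B c Gs T L \<gamma> \<eta> x0 v0 x v w
  proof unfold_locales
    show "monotone_op T" using maxmono by (simp add: maximally_monotone_def)
  qed (fact Lipschitz \<gamma> \<eta> b' p' v0_in init x_step v_step w_step)+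
  define g where "g = \<gamma> * (2 * \<gamma> - 1) * \<eta> - (3 * \<gamma> - 1) * \<kappa>"
  have "\<delta> = L * (\<gamma> * (2 * \<gamma> - 1) * \<eta> / (3 * \<gamma> - 1))"
    unfolding delta_def eta_def using L_pos by simp
  then have "L * \<kappa> < L * (\<gamma> * (2 * \<gamma> - 1) * \<eta> / (3 * \<gamma> - 1))"
    using kappa_small by (simp only:)
  then have "\<kappa> < \<gamma> * (2 * \<gamma> - 1) * \<eta> / (3 * \<gamma> - 1)"
    using L_pos by (simp only: mult_less_cancel_left_pos)
  then have g: "g > 0" using \<gamma> by (simp add: g_def field_simps)
  have \<Theta>_eq: "\<Theta> = (3 * \<gamma> - 1) * \<eta> / ((1 - \<gamma>) * g)" unfolding Theta_def g_def ..
  then have \<Theta>: "\<Theta> > 0" using \<gamma> \<eta> g by simp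
  have R2: "R2 \<ge> 0" by (simp add: R2_def)
  define S where "S K = (\<Sum>k=0..K. expectation (\<lambda>\<omega>. (norm (G (x k \<omega>) + v k \<omega>))\<^sup>2))" for K
  have S_le: "S K \<le> \<Theta> * R2 * L\<^sup>2 * M" for K
  proof -
    have "(norm (x0 + (\<gamma> * \<eta>) *\<^sub>R (G x0 + v0) - xstar))\<^sup>2 \<le> 2 * R2"
    proof -
      have "0 \<le> (norm ((x0 - xstar) - (\<gamma> * \<eta>) *\<^sub>R (G x0 + v0)))\<^sup>2" by simp
      then show ?thesis unfolding R2_def power2_norm_eq_inner
        by (simp add: inner_simps inner_commute power2_eq_square algebra_simps)
    qed
    moreover have "2 * (1 - \<gamma>) * \<eta> * (\<gamma> * (2 * \<gamma> - 1) * \<eta> / (3 * \<gamma> - 1) - \<kappa>)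
      * (\<Sum>k\<le>K. expectation (\<lambda>\<omega>. (norm (F k \<omega>))\<^sup>2)) \<le> (norm (x0 + (\<gamma> * \<eta>) *\<^sub>R (G x0 + v0) - xstar))\<^sup>2"
    proof (rule residual_sum_le[folded G_def])
      show "\<eta>\<^sup>2 * L\<^sup>2 * (4 * \<gamma>\<^sup>2 + 4 * \<gamma> / (1 - \<gamma>) * ((C_now + C_prev) / (p / 2))) \<le> 1"
        unfolding C_now_def C_prev_def M_eq[symmetric] using \<eta>_sq by simp
    qed (rule weak_Minty)
    moreover have "(\<Sum>k\<le>K. expectation (\<lambda>\<omega>. (norm (F k \<omega>))\<^sup>2)) = S K"
      unfolding S_def F_def[folded G_def] atMost_atLeast0 ..
    \<comment> \<open>the origin of the constant \<open>\<Theta>\<close>\<close>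
    moreover have "2 * (1 - \<gamma>) * \<eta> * (\<gamma> * (2 * \<gamma> - 1) * \<eta> / (3 * \<gamma> - 1) - \<kappa>) = 2 * (\<eta>\<^sup>2 / \<Theta>)"
      unfolding \<Theta>_eq using \<gamma> g \<eta> by (simp add: field_simps power2_eq_square g_def)
    ultimately have "\<eta>\<^sup>2 / \<Theta> * S K \<le> R2" by simp
    then have "\<eta>\<^sup>2 * S K \<le> \<Theta> * R2" using \<Theta> by (simp add: field_simps)
    then have "(L\<^sup>2 * M) * (\<eta>\<^sup>2 * S K) \<le> (L\<^sup>2 * M) * (\<Theta> * R2)" using M by (intro mult_left_mono) auto
    moreover have "(L\<^sup>2 * M) * (\<eta>\<^sup>2 * S K) = (\<eta>\<^sup>2 * L\<^sup>2 * M) * S K" by (simp only: mult_ac)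
    ultimately have "S K \<le> (L\<^sup>2 * M) * (\<Theta> * R2)" by (simp only: \<eta>_sq mult_1_left)
    then show ?thesis by (simp only: mult_ac)
  qed
  have \<sigma>M: "\<sigma>\<^sup>2 * (real b * p\<^sup>2) * M \<le> 1" by (rule bounds) (rule bp)
  have part1: "\<eta> \<ge> \<sigma> * sqrt (real b) * p / L"
  proof -
    have "(\<sigma> * sqrt (real b) * p * sqrt M)\<^sup>2 \<le> 1\<^sup>2"
      using \<sigma>M M by (simp add: power_mult_distrib mult_ac)
    then have "\<sigma> * sqrt (real b) * p * sqrt M \<le> 1" by (rule power2_le_imp_le) simp
    then show ?thesis unfolding eta_def using M L_pos by (simp add: field_simps)
  qed
  have part2: "1 / (real K + 1) * S K \<le> \<Theta> * L\<^sup>2 * R2 / (\<sigma>\<^sup>2 * real b * p\<^sup>2 * (real K + 1))" for K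
  proof -
    have pos: "\<sigma>\<^sup>2 * (real b * p\<^sup>2) > 0" using \<sigma> b0 p' by simp
    have "S K * (\<sigma>\<^sup>2 * (real b * p\<^sup>2)) \<le> (\<Theta> * R2 * L\<^sup>2 * M) * (\<sigma>\<^sup>2 * (real b * p\<^sup>2))"
      using pos by (intro mult_right_mono S_le) simp
    also have "\<dots> = (\<Theta> * L\<^sup>2 * R2) * (\<sigma>\<^sup>2 * (real b * p\<^sup>2) * M)" by (simp only: mult_ac)
    also have "\<dots> \<le> \<Theta> * L\<^sup>2 * R2" using \<sigma>M \<Theta> R2 by (intro mult_left_le) auto
    finally have "S K \<le> \<Theta> * L\<^sup>2 * R2 / (\<sigma>\<^sup>2 * (real b * p\<^sup>2))" using pos by (simp only: pos_le_divide_eq)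
    then have "S K / (real K + 1) \<le> \<Theta> * L\<^sup>2 * R2 / (\<sigma>\<^sup>2 * (real b * p\<^sup>2)) / (real K + 1)"
      by (rule divide_right_mono) simp
    then show ?thesis by (simp add: mult_ac)
  qed
  have part3: "\<exists>K. 1 / (real K + 1) * S K \<le> \<epsilon>\<^sup>2
      \<and> expectation (\<lambda>\<omega>. real (component_evals n b (\<lambda>k. c k \<omega>) K))
          \<le> real n + of_int \<lfloor>4 * \<Gamma> * L\<^sup>2 * R2 * real n powr (2 / 3) / \<epsilon>\<^sup>2\<rfloor>
      \<and> int (resolvent_evals K) \<le> \<lfloor>\<Gamma> * L\<^sup>2 * R2 / \<epsilon>\<^sup>2\<rfloor>"
    if \<epsilon>: "\<epsilon> > 0" and n2: "n \<ge> 2" and p_eq: "p = real n powr (- 1 / 3)" and b_eq: "b = nat \<lfloor>real n powr (2 / 3)\<rfloor>"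
    for \<epsilon> :: real
  proof -
    define s where "s = real n powr (2 / 3)"
    have n0: "real n > 0" using n2 by simp
    have s0: "s > 0" using n0 by (simp add: s_def)
    have p2: "p\<^sup>2 = real n powr (- 2 / 3)" and p3: "p ^ 3 = 1 / real n"
      using n0 powr_power[of "real n" "- 1 / 3" 2] powr_power[of "real n" "- 1 / 3" 3]
      unfolding p_eq by (simp_all add: powr_minus_divide)
    have sp: "s * p\<^sup>2 = 1" unfolding p2 s_def using n0 by (simp flip: powr_add)
    have np: "real n * p = s"
      using n0 powr_add[of "real n" 1 "- 1 / 3"] unfolding p_eq s_def by simp
    have bs: "real b \<le> s" "s \<le> real b + 1" unfolding b_eq s_def[symmetric] using s0 by linarith+
    have "p ^ 3 \<le> (4/5) ^ 3" unfolding p3 using n2 by (simp add: power_divide field_simps)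
    then have p45: "p \<le> 4/5" by (simp add: power_mono_iff p'(1) less_imp_le)
    have "s * p\<^sup>2 \<le> (real b + 1) * p\<^sup>2" using bs(2) by (intro mult_right_mono) auto
    then have bp': "real b * p\<^sup>2 \<ge> 1 - p\<^sup>2" unfolding sp by (simp add: distrib_right)
    have \<sigma>M': "\<sigma>\<^sup>2 * (1 + p\<^sup>2 / 4) * M \<le> 1" by (rule bounds(4)[OF p45 bp'])
    \<comment> \<open>\<open>Q'\<close> comes from the bound on \<open>S K\<close> itself, which is sharper than the rate in \<open>part2\<close>\<close>
    define Q Q' where "Q = \<Gamma> * L\<^sup>2 * R2 / \<epsilon>\<^sup>2" and "Q' = \<Theta> * R2 * L\<^sup>2 * M / \<epsilon>\<^sup>2"
    have Q': "0 \<le> Q'" unfolding Q'_def using \<Theta> R2 M by simp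
    have QQ: "Q' * (1 + p\<^sup>2 / 4) \<le> Q"
    proof -
      have "Q' * (1 + p\<^sup>2 / 4) * \<sigma>\<^sup>2 = (\<Theta> * L\<^sup>2 * R2 / \<epsilon>\<^sup>2) * (\<sigma>\<^sup>2 * (1 + p\<^sup>2 / 4) * M)"
        unfolding Q'_def by simp
      also have "\<dots> \<le> \<Theta> * L\<^sup>2 * R2 / \<epsilon>\<^sup>2" using \<sigma>M' \<Theta> R2 by (intro mult_left_le) auto
      finally have "Q' * (1 + p\<^sup>2 / 4) \<le> \<Theta> * L\<^sup>2 * R2 / \<epsilon>\<^sup>2 / \<sigma>\<^sup>2"
        using \<sigma> by (simp only: pos_le_divide_eq zero_less_power)
      also have "\<dots> = Q" unfolding Q_def Gamma_def by simp
      finally show ?thesis .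
    qed
    obtain K where K: "Q' \<le> real K + 1" "real K * (3 * real b + s) \<le> of_int \<lfloor>4 * Q * s\<rfloor>" "int K \<le> \<lfloor>Q\<rfloor>"
      using iteration_count[OF sp s0 bs(1) Q' QQ] by blast
    have "S K \<le> Q' * \<epsilon>\<^sup>2" unfolding Q'_def using S_le[of K] \<epsilon> by simp
    also have "\<dots> \<le> (real K + 1) * \<epsilon>\<^sup>2" by (intro mult_right_mono K) simp
    finally have "1 / (real K + 1) * S K \<le> \<epsilon>\<^sup>2" by (simp add: field_simps)
    moreover have "expectation (\<lambda>\<omega>. real (component_evals n b (\<lambda>k. c k \<omega>) K))
          \<le> real n + of_int \<lfloor>4 * \<Gamma> * L\<^sup>2 * R2 * real n powr (2 / 3) / \<epsilon>\<^sup>2\<rfloor>"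
    proof -
      have "4 * \<Gamma> * L\<^sup>2 * R2 * real n powr (2 / 3) / \<epsilon>\<^sup>2 = 4 * Q * s" by (simp add: Q_def s_def)
      then show ?thesis unfolding expectation_component_evals np using K(2) by simp
    qed
    moreover have "int (resolvent_evals K) \<le> \<lfloor>\<Gamma> * L\<^sup>2 * R2 / \<epsilon>\<^sup>2\<rfloor>"
      using K(3) by (simp add: resolvent_evals_def Q_def)
    ultimately show ?thesis by blast
  qed
  show ?thesis using part1 part2 part3 unfolding S_def by blast
qed

end
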